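(* The category $\mathsf{Qs}(\mathbb{T},V)\text{-}\mathsf{Cat}$ of quasi-$(\mathbb{T},V)$-spaces and quasi-$(\mathbb{T},V)$-continuous maps is cartesian closed.
   Context: Setting. $V=(V,\otimes,k)$ is a unital commutative quantale (a complete lattice with a commutative associative operation $\otimes$ with unit $k$ that preserves arbitrary suprema in each variable) which is also a Heyting algebra (each $u\wedge(-)$ has a right adjoint); $\bot,\top$ denote bottom and top. A $V$-relation $r\colon X\nrightarrow Y$ is a map $r\colon X\times Y\to V$; composition is $(s\cdot r)(x,z)=\bigvee_{y}r(x,y)\otimes s(y,z)$, the order is componentwise, and $r^{\circ}(y,x)=r(x,y)$. A map $f\colon X\to Y$ is regarded as the $V$-relation with $f(x,y)=k$ if $f(x)=y$ and $\bot$ otherwise. $\mathbb{T}=(T,m,e)$ is a monad on $\mathsf{Set}$ satisfying (BC): $T$ preserves weak pullbacks and the naturality squares of $m$ are weak pullbacks. A lax extension of $\mathbb{T}$ to $V$-relations is fixed, sending $r\colon X\nrightarrow Y$ to $Tr\colon TX\nrightarrow TY$: it is monotone, $Ts\cdot Tr\le T(s\cdot r)$, it is flat (the extension satisfies $T1_X=1_{TX}$, so that it agrees with $T$ on maps), $T(r^{\circ})=(Tr)^{\circ}$, $e_Y\cdot r\le Tr\cdot e_X$ and $m_Y\cdot TTr\le Tr\cdot m_X$. A $(\mathbb{T},V)$-space is a pair $(X,a)$ with $a\colon TX\nrightarrow X$ a $V$-relation such that $1_X\le a\cdot e_X$ and $a\cdot Ta\le a\cdot m_X$. A map $f\colon(X,a)\to(Y,b)$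 is $(\mathbb{T},V)$-continuous if $f\cdot a\le b\cdot Tf$, i.e. $a(\mathfrak{x},x)\le b(Tf(\mathfrak{x}),f(x))$ for all $\mathfrak{x}\in TX,x\in X$. These form the category $(\mathbb{T},V)\text{-}\mathsf{Cat}$, whose forgetful functor to $\mathsf{Set}$ is topological. A space $(X,a)$ is compact if $1_{TX}\le a^{\circ}\cdot a$, i.e. $k\le\bigvee_{x\in X}a(\mathfrak{x},x)\otimes a(\mathfrak{x},x)$ for all $\mathfrak{x}\in TX$; it is Hausdorff if $a\cdot a^{\circ}\le 1_X$, i.e. $\bot<a(\mathfrak{x},x)\otimes a(\mathfrak{x},y)$ implies $x=y$, and $a(\mathfrak{x},x)\otimes a(\mathfrak{x},x)\le k$, for all $\mathfrak{x}\in TX$, $x,y\in X$. $\mathcal{C}$ denotes the full subcategory of $(\mathbb{T},V)\text{-}\mathsf{Cat}$ of compact Hausdorff spaces. Standing assumptions: every constant map between $(\mathbb{T},V)$-spaces is continuous, and $\mathcal{C}$ is closed in $(\mathbb{T},V)\text{-}\mathsf{Cat}$ under finite coproducts, binary products and equalizers. For a map $\alpha\colon C\to X$ into a set $X$ and a finite family $(\alpha_i\colon C_i\to X)_{i\in I}$ of maps, with $C,C_i\in\mathcal{C}$, $\alpha$ is covered by $(\alpha_i)_{i\in I}$ if there is a surjective continuous map $\eta\colon\coprod_{i\in I}C_i\to C$ (coproduct in $(\mathbb{T},V)\text{-}\mathsf{Cat}$) such that $\alpha\cdot\eta$ is the map $\coprod_i C_i\to X$ induced by the $\alpha_i$. A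 quasi-$(\mathbb{T},V)$-space is a set $X$ together with, for each $C\in\mathcal{C}$, a set $Q(C,X)$ of functions from $C$ to $X$ (the admissible maps) such that: (QS1) $Q(C,X)$ contains all constant maps; (QS2) if $h\colon C_1\to C_2$ is continuous, $C_1,C_2\in\mathcal{C}$, and $\alpha\in Q(C_2,X)$, then $\alpha\cdot h\in Q(C_1,X)$; (QS3) $\alpha\in Q(C,X)$ if and only if $\alpha$ is covered by a (finite) family of admissible maps. A map $f\colon X\to Y$ between quasi-spaces is quasi-$(\mathbb{T},V)$-continuous if $f\cdot\alpha\in Q(C,Y)$ for all $C\in\mathcal{C}$ and $\alpha\in Q(C,X)$. Despite the size issue that the quasi-spaces do not form a class, $\mathsf{Qs}(\mathbb{T},V)\text{-}\mathsf{Cat}$ is still called a category. *)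

theory Defs
  imports Main "HOL-Library.FuncSet"
begin

section \<open>The universe of sets\<close>

text \<open>
  A HOL type does not range over all sets, so the category of sets is formed inside a type
  that satisfies the axioms of ZFC (choice is inherited from HOL): \<open>elts x\<close> is the extension
  of the set \<open>x\<close>, and the sets of the category are the subsets of the type that are the
  extension of some element. All other subsets play the role of proper classes.
\<close>

class set_universe =
  fixes elts :: "'a \<Rightarrow> 'a set"
  assumes extensionality: "elts x = elts y \<Longrightarrow> x = y"
    and foundation: "wf {(x, y). x \<in> elts y}"
    and separation: "A \<in> range elts \<Longrightarrow> B \<subseteq> A \<Longrightarrow> B \<in> range elts"
    and union: "A \<in> range elts \<Longrightarrow> \<Union> (elts ` A) \<in> range elts"
    and power: "A \<in> range elts \<Longrightarrow> {x. elts x \<subseteq> A} \<in> range elts"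
    and replacement: "A \<in> range elts \<Longrightarrow> f ` A \<in> range elts"
    and infinity: "range (g :: nat \<Rightarrow> 'a) \<in> range elts"

definition small :: "'u::set_universe set \<Rightarrow> bool" where
  "small A \<longleftrightarrow> A \<in> range elts"

section \<open>Categories\<close>

text \<open>
  Hom-sets need not be disjoint; \<open>Comp K A B C g f\<close> is the composite of \<open>f : A \<rightarrow> B\<close> and
  \<open>g : B \<rightarrow> C\<close>.
\<close>

record ('o, 'm) category =
  Obj :: "'o set"
  Hom :: "'o \<Rightarrow> 'o \<Rightarrow> 'm set"
  Id :: "'o \<Rightarrow> 'm"
  Comp :: "'o \<Rightarrow> 'o \<Rightarrow> 'o \<Rightarrow> 'm \<Rightarrow> 'm \<Rightarrow> 'm"

definition is_category :: "('o, 'm) category \<Rightarrow> bool" where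
  "is_category K \<longleftrightarrow>
     (\<forall>A\<in>Obj K. Id K A \<in> Hom K A A) \<and>
     (\<forall>A\<in>Obj K. \<forall>B\<in>Obj K. \<forall>C\<in>Obj K. \<forall>f\<in>Hom K A B. \<forall>g\<in>Hom K B C.
        Comp K A B C g f \<in> Hom K A C) \<and>
     (\<forall>A\<in>Obj K. \<forall>B\<in>Obj K. \<forall>f\<in>Hom K A B.
        Comp K A A B f (Id K A) = f \<and> Comp K A B B (Id K B) f = f) \<and>
     (\<forall>A\<in>Obj K. \<forall>B\<in>Obj K. \<forall>C\<in>Obj K. \<forall>D\<in>Obj K.
        \<forall>f\<in>Hom K A B. \<forall>g\<in>Hom K B C. \<forall>h\<in>Hom K C D.
        Comp K A B D (Comp K B C D h g) f = Comp K A C D h (Comp K A B C g f))"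

definition is_terminal :: "('o, 'm) category \<Rightarrow> 'o \<Rightarrow> bool" where
  "is_terminal K t \<longleftrightarrow> t \<in> Obj K \<and> (\<forall>A\<in>Obj K. \<exists>!f. f \<in> Hom K A t)"

definition is_product ::
  "('o, 'm) category \<Rightarrow> 'o \<Rightarrow> 'o \<Rightarrow> 'o \<Rightarrow> 'm \<Rightarrow> 'm \<Rightarrow> bool" where
  "is_product K A B P p q \<longleftrightarrow>
     A \<in> Obj K \<and> B \<in> Obj K \<and> P \<in> Obj K \<and> p \<in> Hom K P A \<and> q \<in> Hom K P B \<and>
     (\<forall>Z\<in>Obj K. \<forall>f\<in>Hom K Z A. \<forall>g\<in>Hom K Z B.
        \<exists>!u. u \<in> Hom K Z P \<and> Comp K Z P A p u = f \<and> Comp K Z P B q u = g)"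

definition is_equalizer ::
  "('o, 'm) category \<Rightarrow> 'o \<Rightarrow> 'o \<Rightarrow> 'm \<Rightarrow> 'm \<Rightarrow> 'o \<Rightarrow> 'm \<Rightarrow> bool" where
  "is_equalizer K A B f g E i \<longleftrightarrow>
     A \<in> Obj K \<and> B \<in> Obj K \<and> E \<in> Obj K \<and> f \<in> Hom K A B \<and> g \<in> Hom K A B \<and>
     i \<in> Hom K E A \<and> Comp K E A B f i = Comp K E A B g i \<and>
     (\<forall>Z\<in>Obj K. \<forall>h\<in>Hom K Z A. Comp K Z A B f h = Comp K Z A B g h \<longrightarrow>
        (\<exists>!u. u \<in> Hom K Z E \<and> Comp K Z E A i u = h))"

definition is_coproduct ::
  "('o, 'm) category \<Rightarrow> 'i set \<Rightarrow> ('i \<Rightarrow> 'o) \<Rightarrow> 'o \<Rightarrow> ('i \<Rightarrow> 'm) \<Rightarrow> bool" where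
  "is_coproduct K I A S \<iota> \<longleftrightarrow>
     (\<forall>i\<in>I. A i \<in> Obj K) \<and> S \<in> Obj K \<and> (\<forall>i\<in>I. \<iota> i \<in> Hom K (A i) S) \<and>
     (\<forall>Z\<in>Obj K. \<forall>f. (\<forall>i\<in>I. f i \<in> Hom K (A i) Z) \<longrightarrow>
        (\<exists>!u. u \<in> Hom K S Z \<and> (\<forall>i\<in>I. Comp K (A i) S Z u (\<iota> i) = f i)))"

definition is_weak_pullback ::
  "('o, 'm) category \<Rightarrow> 'o \<Rightarrow> 'o \<Rightarrow> 'o \<Rightarrow> 'o \<Rightarrow> 'm \<Rightarrow> 'm \<Rightarrow> 'm \<Rightarrow> 'm \<Rightarrow> bool" where
  "is_weak_pullback K P A B C p q f g \<longleftrightarrow>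
     P \<in> Obj K \<and> A \<in> Obj K \<and> B \<in> Obj K \<and> C \<in> Obj K \<and>
     p \<in> Hom K P A \<and> q \<in> Hom K P B \<and> f \<in> Hom K A C \<and> g \<in> Hom K B C \<and>
     Comp K P A C f p = Comp K P B C g q \<and>
     (\<forall>Z\<in>Obj K. \<forall>p'\<in>Hom K Z A. \<forall>q'\<in>Hom K Z B. Comp K Z A C f p' = Comp K Z B C g q' \<longrightarrow>
        (\<exists>u\<in>Hom K Z P. Comp K Z P A p u = p' \<and> Comp K Z P B q u = q'))"

text \<open>
  In the universal property below, \<open>R\<close> is any product of \<open>Z\<close> and \<open>A\<close>, and \<open>u\<close> is the morphism
  \<open>g \<times> 1\<close> from \<open>R\<close> to \<open>P\<close>.
\<close>

definition is_exponential ::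
  "('o, 'm) category \<Rightarrow> 'o \<Rightarrow> 'o \<Rightarrow> 'o \<Rightarrow> 'o \<Rightarrow> 'm \<Rightarrow> 'm \<Rightarrow> 'm \<Rightarrow> bool" where
  "is_exponential K A B E P p q ev \<longleftrightarrow>
     B \<in> Obj K \<and> is_product K E A P p q \<and> ev \<in> Hom K P B \<and>
     (\<forall>Z R p' q'. is_product K Z A R p' q' \<longrightarrow>
        (\<forall>f\<in>Hom K R B. \<exists>!g. g \<in> Hom K Z E \<and>
           (\<exists>u\<in>Hom K R P. Comp K R P E p u = Comp K R Z E g p' \<and>
                          Comp K R P A q u = q' \<and> Comp K R P B ev u = f)))"

definition cartesian_closed :: "('o, 'm) category \<Rightarrow> bool" where
  "cartesian_closed K \<longleftrightarrow>
     is_category K \<and>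
     (\<exists>t. is_terminal K t) \<and>
     (\<forall>A\<in>Obj K. \<forall>B\<in>Obj K. \<exists>P p q. is_product K A B P p q) \<and>
     (\<forall>A\<in>Obj K. \<forall>B\<in>Obj K. \<exists>E P p q ev. is_exponential K A B E P p q ev)"

definition SetCat :: "('u::set_universe set, 'u \<Rightarrow> 'u) category" where
  "SetCat = \<lparr>Obj = {X. small X}, Hom = (\<lambda>X Y. X \<rightarrow>\<^sub>E Y), Id = (\<lambda>X. \<lambda>x\<in>X. x),
             Comp = (\<lambda>X Y Z g f. compose X g f)\<rparr>"

section \<open>Quantales and relations\<close>

text \<open>The tensor is written \<open>*\<close> and its unit \<open>k\<close> is written \<open>1\<close>.\<close>

class comm_quantale = complete_lattice + comm_monoid_mult +
  assumes mult_Sup: "u * Sup A = Sup ((\<lambda>v. u * v) ` A)"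

class heyting_comm_quantale = comm_quantale +
  assumes inf_right_adjoint: "\<exists>h. \<forall>v w. inf u v \<le> w \<longleftrightarrow> v \<le> h w"

text \<open>
  A relation from \<open>X\<close> to \<open>Y\<close> is represented by its extension by \<open>bot\<close> to the whole type. The
  supremum in \<open>vcomp\<close> may therefore run over the whole type: points outside the middle set
  contribute \<open>bot\<close>.
\<close>

definition vrel :: "'u set \<Rightarrow> 'u set \<Rightarrow> ('u \<Rightarrow> 'u \<Rightarrow> 'v::comm_quantale) set" where
  "vrel X Y = {r. \<forall>x y. x \<notin> X \<or> y \<notin> Y \<longrightarrow> r x y = bot}"

definition vcomp ::
  "('u \<Rightarrow> 'u \<Rightarrow> 'v::comm_quantale) \<Rightarrow> ('u \<Rightarrow> 'u \<Rightarrow> 'v) \<Rightarrow> 'u \<Rightarrow> 'u \<Rightarrow> 'v" (infixl "\<odot>" 70) where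
  "s \<odot> r = (\<lambda>x z. SUP y. r x y * s y z)"

definition vconv :: "('u \<Rightarrow> 'u \<Rightarrow> 'v) \<Rightarrow> 'u \<Rightarrow> 'u \<Rightarrow> 'v" where
  "vconv r = (\<lambda>y x. r x y)"

definition vgraph :: "'u set \<Rightarrow> ('u \<Rightarrow> 'u) \<Rightarrow> 'u \<Rightarrow> 'u \<Rightarrow> 'v::comm_quantale" where
  "vgraph X f = (\<lambda>x y. if x \<in> X \<and> f x = y then 1 else bot)"

definition vid :: "'u set \<Rightarrow> 'u \<Rightarrow> 'u \<Rightarrow> 'v::comm_quantale" where
  "vid X = vgraph X (\<lambda>x. x)"

section \<open>Monads with a lax extension\<close>

text \<open>
  The data of a monad on the category of sets and of an extension of its functor to relations:
  \<open>TMap D X Y f\<close> is the image of \<open>f : X \<rightarrow> Y\<close> and \<open>TRel D X Y r\<close> that of a relation \<open>r\<close> from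
  \<open>X\<close> to \<open>Y\<close>.
\<close>

record ('u, 'v) monad_data =
  TSet :: "'u set \<Rightarrow> 'u set"
  TMap :: "'u set \<Rightarrow> 'u set \<Rightarrow> ('u \<Rightarrow> 'u) \<Rightarrow> 'u \<Rightarrow> 'u"
  Unit :: "'u set \<Rightarrow> 'u \<Rightarrow> 'u"
  Mult :: "'u set \<Rightarrow> 'u \<Rightarrow> 'u"
  TRel :: "'u set \<Rightarrow> 'u set \<Rightarrow> ('u \<Rightarrow> 'u \<Rightarrow> 'v) \<Rightarrow> 'u \<Rightarrow> 'u \<Rightarrow> 'v"

definition is_functor ::
  "('o, 'm) category \<Rightarrow> ('o \<Rightarrow> 'o) \<Rightarrow> ('o \<Rightarrow> 'o \<Rightarrow> 'm \<Rightarrow> 'm) \<Rightarrow> bool" where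
  "is_functor K F FM \<longleftrightarrow>
     (\<forall>A\<in>Obj K. F A \<in> Obj K) \<and>
     (\<forall>A\<in>Obj K. \<forall>B\<in>Obj K. \<forall>f\<in>Hom K A B. FM A B f \<in> Hom K (F A) (F B)) \<and>
     (\<forall>A\<in>Obj K. FM A A (Id K A) = Id K (F A)) \<and>
     (\<forall>A\<in>Obj K. \<forall>B\<in>Obj K. \<forall>C\<in>Obj K. \<forall>f\<in>Hom K A B. \<forall>g\<in>Hom K B C.
        FM A C (Comp K A B C g f) = Comp K (F A) (F B) (F C) (FM B C g) (FM A B f))"

definition is_monad ::
  "('o, 'm) category \<Rightarrow> ('o \<Rightarrow> 'o) \<Rightarrow> ('o \<Rightarrow> 'o \<Rightarrow> 'm \<Rightarrow> 'm) \<Rightarrow> ('o \<Rightarrow> 'm) \<Rightarrow> ('o \<Rightarrow> 'm) \<Rightarrow> bool"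
  where
  "is_monad K F FM e m \<longleftrightarrow>
     is_functor K F FM \<and>
     (\<forall>A\<in>Obj K. e A \<in> Hom K A (F A) \<and> m A \<in> Hom K (F (F A)) (F A)) \<and>
     (\<forall>A\<in>Obj K. \<forall>B\<in>Obj K. \<forall>f\<in>Hom K A B.
        Comp K A (F A) (F B) (FM A B f) (e A) = Comp K A B (F B) (e B) f \<and>
        Comp K (F (F A)) (F A) (F B) (FM A B f) (m A) =
          Comp K (F (F A)) (F (F B)) (F B) (m B) (FM (F A) (F B) (FM A B f))) \<and>
     (\<forall>A\<in>Obj K.
        Comp K (F A) (F (F A)) (F A) (m A) (e (F A)) = Id K (F A) \<and>
        Comp K (F A) (F (F A)) (F A) (m A) (FM A (F A) (e A)) = Id K (F A) \<and>
        Comp K (F (F (F A))) (F (F A)) (F A) (m A) (m (F A)) =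
          Comp K (F (F (F A))) (F (F A)) (F A) (m A) (FM (F (F A)) (F A) (m A)))"

definition satisfies_BC :: "('u::set_universe, 'v) monad_data \<Rightarrow> bool" where
  "satisfies_BC D \<longleftrightarrow>
     (\<forall>P A B C p q f g. is_weak_pullback SetCat P A B C p q f g \<longrightarrow>
        is_weak_pullback SetCat (TSet D P) (TSet D A) (TSet D B) (TSet D C)
          (TMap D P A p) (TMap D P B q) (TMap D A C f) (TMap D B C g)) \<and>
     (\<forall>X Y f. small X \<and> small Y \<and> f \<in> X \<rightarrow>\<^sub>E Y \<longrightarrow>
        is_weak_pullback SetCat
          (TSet D (TSet D X)) (TSet D X) (TSet D (TSet D Y)) (TSet D Y)
          (Mult D X) (TMap D (TSet D X) (TSet D Y) (TMap D X Y f))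
          (TMap D X Y f) (Mult D Y))"

definition is_flat_lax_extension ::
  "('u::set_universe, 'v::comm_quantale) monad_data \<Rightarrow> bool" where
  "is_flat_lax_extension D \<longleftrightarrow>
     (\<forall>X Y. small X \<and> small Y \<longrightarrow>
        (\<forall>r\<in>vrel X Y. TRel D X Y r \<in> vrel (TSet D X) (TSet D Y)) \<and>
        (\<forall>r\<in>vrel X Y. \<forall>r'\<in>vrel X Y. r \<le> r' \<longrightarrow> TRel D X Y r \<le> TRel D X Y r') \<and>
        (\<forall>f\<in>X \<rightarrow>\<^sub>E Y. TRel D X Y (vgraph X f) = vgraph (TSet D X) (TMap D X Y f)) \<and>
        (\<forall>r\<in>vrel X Y. TRel D Y X (vconv r) = vconv (TRel D X Y r)) \<and>
        (\<forall>r\<in>vrel X Y. vgraph Y (Unit D Y) \<odot> r \<le> TRel D X Y r \<odot> vgraph X (Unit D X)) \<and>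
        (\<forall>r\<in>vrel X Y.
           vgraph (TSet D (TSet D Y)) (Mult D Y) \<odot> TRel D (TSet D X) (TSet D Y) (TRel D X Y r)
           \<le> TRel D X Y r \<odot> vgraph (TSet D (TSet D X)) (Mult D X))) \<and>
     (\<forall>X. small X \<longrightarrow> TRel D X X (vid X) = vid (TSet D X)) \<and>
     (\<forall>X Y Z. small X \<and> small Y \<and> small Z \<longrightarrow>
        (\<forall>r\<in>vrel X Y. \<forall>s\<in>vrel Y Z. TRel D Y Z s \<odot> TRel D X Y r \<le> TRel D X Z (s \<odot> r)))"

definition is_setting :: "('u::set_universe, 'v::comm_quantale) monad_data \<Rightarrow> bool" where
  "is_setting D \<longleftrightarrow>
     is_monad SetCat (TSet D) (TMap D) (Unit D) (Mult D) \<and> satisfies_BC D \<and>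
     is_flat_lax_extension D"

section \<open>Spaces\<close>

record ('u, 'v) tv_space =
  points :: "'u set"
  conv :: "'u \<Rightarrow> 'u \<Rightarrow> 'v"

definition is_space ::
  "('u::set_universe, 'v::comm_quantale) monad_data \<Rightarrow> ('u, 'v) tv_space \<Rightarrow> bool" where
  "is_space D A \<longleftrightarrow>
     small (points A) \<and> conv A \<in> vrel (TSet D (points A)) (points A) \<and>
     vid (points A) \<le> conv A \<odot> vgraph (points A) (Unit D (points A)) \<and>
     conv A \<odot> TRel D (TSet D (points A)) (points A) (conv A)
       \<le> conv A \<odot> vgraph (TSet D (TSet D (points A))) (Mult D (points A))"

definition continuous_maps ::
  "('u::set_universe, 'v::comm_quantale) monad_data \<Rightarrow> ('u, 'v) tv_space \<Rightarrow> ('u, 'v) tv_space \<Rightarrow>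
     ('u \<Rightarrow> 'u) set" where
  "continuous_maps D A B =
     {f \<in> points A \<rightarrow>\<^sub>E points B.
        vgraph (points A) f \<odot> conv A
          \<le> conv B \<odot> vgraph (TSet D (points A)) (TMap D (points A) (points B) f)}"

definition TVCat ::
  "('u::set_universe, 'v::comm_quantale) monad_data \<Rightarrow> (('u, 'v) tv_space, 'u \<Rightarrow> 'u) category"
  where
  "TVCat D = \<lparr>Obj = {A. is_space D A}, Hom = continuous_maps D, Id = (\<lambda>A. \<lambda>x\<in>points A. x),
              Comp = (\<lambda>A B C g f. compose (points A) g f)\<rparr>"

definition compact_space ::
  "('u::set_universe, 'v::comm_quantale) monad_data \<Rightarrow> ('u, 'v) tv_space \<Rightarrow> bool" where
  "compact_space D A \<longleftrightarrow> vid (TSet D (points A)) \<le> vconv (conv A) \<odot> conv A"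

definition hausdorff_space :: "('u, 'v::comm_quantale) tv_space \<Rightarrow> bool" where
  "hausdorff_space A \<longleftrightarrow> conv A \<odot> vconv (conv A) \<le> vid (points A)"

definition CompHaus ::
  "('u::set_universe, 'v::comm_quantale) monad_data \<Rightarrow> ('u, 'v) tv_space set" where
  "CompHaus D = {A. is_space D A \<and> compact_space D A \<and> hausdorff_space A}"

definition constant_maps :: "'u set \<Rightarrow> 'u set \<Rightarrow> ('u \<Rightarrow> 'u) set" where
  "constant_maps X Y = {f. \<exists>y\<in>Y. f = (\<lambda>x\<in>X. y)}"

definition constants_continuous ::
  "('u::set_universe, 'v::comm_quantale) monad_data \<Rightarrow> bool" where
  "constants_continuous D \<longleftrightarrow>
     (\<forall>A B. is_space D A \<and> is_space D B \<longrightarrow>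
        constant_maps (points A) (points B) \<subseteq> continuous_maps D A B)"

text \<open>Finite families are indexed by finite sets of natural numbers, including the empty set.\<close>

definition CompHaus_closed ::
  "('u::set_universe, 'v::comm_quantale) monad_data \<Rightarrow> bool" where
  "CompHaus_closed D \<longleftrightarrow>
     (\<forall>(I :: nat set) A S \<iota>. finite I \<and> (\<forall>i\<in>I. A i \<in> CompHaus D) \<and>
        is_coproduct (TVCat D) I A S \<iota> \<longrightarrow> S \<in> CompHaus D) \<and>
     (\<forall>A B P p q. A \<in> CompHaus D \<and> B \<in> CompHaus D \<and>
        is_product (TVCat D) A B P p q \<longrightarrow> P \<in> CompHaus D) \<and>
     (\<forall>A B f g E i. A \<in> CompHaus D \<and> B \<in> CompHaus D \<and>
        is_equalizer (TVCat D) A B f g E i \<longrightarrow> E \<in> CompHaus D)"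

section \<open>Quasi-spaces\<close>

text \<open>
  The coproduct injections are jointly surjective, so the equations below determine
  \<open>\<alpha> \<cdot> \<eta>\<close> as the map induced by the \<open>\<alpha>s i\<close>.
\<close>

definition is_covered ::
  "('u::set_universe, 'v::comm_quantale) monad_data \<Rightarrow> ('u, 'v) tv_space \<Rightarrow> ('u \<Rightarrow> 'u) \<Rightarrow>
     nat set \<Rightarrow> (nat \<Rightarrow> ('u, 'v) tv_space) \<Rightarrow> (nat \<Rightarrow> 'u \<Rightarrow> 'u) \<Rightarrow> bool" where
  "is_covered D C \<alpha> I Cs \<alpha>s \<longleftrightarrow>
     (\<exists>S \<iota> \<eta>. is_coproduct (TVCat D) I Cs S \<iota> \<and>
        \<eta> \<in> continuous_maps D S C \<and> \<eta> ` points S = points C \<and>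
        (\<forall>i\<in>I. compose (points (Cs i)) (compose (points S) \<alpha> \<eta>) (\<iota> i) = \<alpha>s i))"

record ('u, 'v) quasi_space =
  qpoints :: "'u set"
  admissible :: "('u, 'v) tv_space \<Rightarrow> ('u \<Rightarrow> 'u) set"

text \<open>
  A family of sets of admissible maps indexed by the compact Hausdorff spaces is represented by
  its extension by the empty set to all values of the index type.
\<close>

definition is_quasi_space ::
  "('u::set_universe, 'v::comm_quantale) monad_data \<Rightarrow> ('u, 'v) quasi_space \<Rightarrow> bool" where
  "is_quasi_space D X \<longleftrightarrow>
     small (qpoints X) \<and>
     (\<forall>C. C \<notin> CompHaus D \<longrightarrow> admissible X C = {}) \<and>
     (\<forall>C\<in>CompHaus D. admissible X C \<subseteq> points C \<rightarrow>\<^sub>E qpoints X) \<and>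
     \<comment> \<open>(QS1)\<close>
     (\<forall>C\<in>CompHaus D. constant_maps (points C) (qpoints X) \<subseteq> admissible X C) \<and>
     \<comment> \<open>(QS2)\<close>
     (\<forall>C\<^sub>1\<in>CompHaus D. \<forall>C\<^sub>2\<in>CompHaus D. \<forall>h\<in>continuous_maps D C\<^sub>1 C\<^sub>2. \<forall>\<alpha>\<in>admissible X C\<^sub>2.
        compose (points C\<^sub>1) \<alpha> h \<in> admissible X C\<^sub>1) \<and>
     \<comment> \<open>(QS3)\<close>
     (\<forall>C\<in>CompHaus D. \<forall>\<alpha>\<in>points C \<rightarrow>\<^sub>E qpoints X.
        \<alpha> \<in> admissible X C \<longleftrightarrow>
        (\<exists>I Cs \<alpha>s. finite I \<and> (\<forall>i\<in>I. Cs i \<in> CompHaus D \<and> \<alpha>s i \<in> admissible X (Cs i)) \<and>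
           is_covered D C \<alpha> I Cs \<alpha>s))"

definition quasi_continuous_maps ::
  "('u::set_universe, 'v::comm_quantale) monad_data \<Rightarrow> ('u, 'v) quasi_space \<Rightarrow>
     ('u, 'v) quasi_space \<Rightarrow> ('u \<Rightarrow> 'u) set" where
  "quasi_continuous_maps D X Y =
     {f \<in> qpoints X \<rightarrow>\<^sub>E qpoints Y.
        \<forall>C\<in>CompHaus D. \<forall>\<alpha>\<in>admissible X C. compose (points C) f \<alpha> \<in> admissible Y C}"

definition QsCat ::
  "('u::set_universe, 'v::comm_quantale) monad_data \<Rightarrow> (('u, 'v) quasi_space, 'u \<Rightarrow> 'u) category"
  where
  "QsCat D = \<lparr>Obj = {X. is_quasi_space D X}, Hom = quasi_continuous_maps D,
              Id = (\<lambda>X. \<lambda>x\<in>qpoints X. x),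
              Comp = (\<lambda>X Y Z g f. compose (qpoints X) g f)\<rparr>"

end

theory Submission
  imports Defs
begin

text \<open>
  The exponential \<open>B\<^sup>A\<close> of quasi-spaces is the set of quasi-continuous maps \<open>A \<rightarrow> B\<close>. A map
  \<open>\<alpha> : C \<rightarrow> B\<^sup>A\<close> is admissible if, for all continuous \<open>h : C' \<rightarrow> C\<close> and admissible \<open>\<beta> : C' \<rightarrow> A\<close>, the
  map \<open>c \<mapsto> \<alpha>(h c)(\<beta> c)\<close> from \<open>C'\<close> to \<open>B\<close> is admissible. With this choice evaluation is quasi-continuous
  (take \<open>h = 1\<close>) and so is the transpose of any quasi-continuous map \<open>Z \<times> A \<rightarrow> B\<close>, because
  \<open>c \<mapsto> (\<gamma>(h c), \<beta> c)\<close> is admissible whenever \<open>\<gamma>\<close> and \<open>\<beta>\<close> are. The only difficulty is that the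
  exponential satisfies (QS3): maps covered by admissible maps must be admissible.

  Covers have to be pulled back along \<open>h\<close> for this (\<open>qexp_cover\<close>). Pullbacks of compact Hausdorff
  spaces are compact Hausdorff, being equalizers of products (\<open>pullback_exists\<close>); the injections of a
  coproduct are jointly surjective (\<open>coproduct_jointly_surjective\<close>), so that the pullbacks of the
  members of a cover are again jointly surjective, and the map out of their coproduct exhibits them
  as a cover.

  Products, equalizers and coproducts of spaces all come from one construction, the initial
  structure for a family of maps into spaces (\<open>is_space_initial\<close>): it is the pointwise infimum of
  the structures induced by the single maps. That it is transitive rests on the monotonicity of the
  lax extension along maps (\<open>Tr_map_mono\<close>). Likewise the terminal quasi-space and the products of
  quasi-spaces carry initial structures: a map into them is admissible if its components are.

  The points of a space are elements of the universe type. Points of products, exponentials and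
  coproducts are therefore encoded as such elements, pairs in the sense of Kuratowski and functions by
  their graphs.
\<close>

section \<open>Pairs, functions and numbers as elements of the universe\<close>

definition code :: "'u::set_universe set \<Rightarrow> 'u" where
  "code A = inv elts A"

lemma elts_code: "small A \<Longrightarrow> elts (code A) = A"
  unfolding code_def small_def by (rule f_inv_into_f)

lemma small_subset: "small A \<Longrightarrow> B \<subseteq> A \<Longrightarrow> small B"
  unfolding small_def by (rule separation)

lemma small_image: "small A \<Longrightarrow> small (f ` A)" for f :: "'u::set_universe \<Rightarrow> 'u"
  unfolding small_def by (rule replacement)

lemma small_range_nat: "small (f ` (I :: nat set))"
  by (rule small_subset[of "range f"]) (auto simp: small_def infinity)

lemma small_empty [simp]: "small {}"
  using small_range_nat[of undefined "{}"] by simp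

lemma small_doubleton [simp]: "small {a, b}"
proof -
  have "{a, b} = (\<lambda>n::nat. if n = 0 then a else b) ` UNIV"
    by auto
  then show ?thesis
    by (metis small_range_nat)
qed

lemma small_singleton [simp]: "small {a}"
  using small_doubleton[of a a] by simp

lemma small_Union:
  assumes "small (code ` F)" and "\<And>A. A \<in> F \<Longrightarrow> small A"
  shows "small (\<Union>F)"
proof -
  have "\<Union>F = \<Union> (elts ` code ` F)"
    using assms(2) by (force simp: elts_code)
  then show ?thesis
    using assms(1) union[of "code ` F"] by (simp add: small_def)
qed

lemma small_UN:
  fixes A :: "'u::set_universe set" and B :: "'u \<Rightarrow> 'u set"
  assumes "small A" and "\<And>a. a \<in> A \<Longrightarrow> small (B a)"
  shows "small (\<Union>a\<in>A. B a)"
  by (rule small_Union) (use assms small_image[of A "\<lambda>a. code (B a)"] in \<open>auto simp: image_image\<close>)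

lemma small_UN_nat:
  fixes I :: "nat set" and B :: "nat \<Rightarrow> 'u::set_universe set"
  assumes "\<And>i. i \<in> I \<Longrightarrow> small (B i)"
  shows "small (\<Union>i\<in>I. B i)"
  by (rule small_Union) (use assms small_range_nat[of "\<lambda>i. code (B i)"] in \<open>auto simp: image_image\<close>)

lemma code_eq_iff: "small A \<Longrightarrow> small B \<Longrightarrow> code A = code B \<longleftrightarrow> A = B"
  by (metis elts_code)

definition pair :: "'u::set_universe \<Rightarrow> 'u \<Rightarrow> 'u" where
  "pair a b = code {code {a}, code {a, b}}"

lemma pair_eq_iff [simp]: "pair a b = pair c d \<longleftrightarrow> a = c \<and> b = d"
  by (auto simp: pair_def code_eq_iff doubleton_eq_iff)

definition pfst :: "'u::set_universe \<Rightarrow> 'u" where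
  "pfst p = (THE a. \<exists>b. p = pair a b)"

definition psnd :: "'u::set_universe \<Rightarrow> 'u" where
  "psnd p = (THE b. \<exists>a. p = pair a b)"

lemma pfst_pair [simp]: "pfst (pair a b) = a"
  by (simp add: pfst_def)

lemma psnd_pair [simp]: "psnd (pair a b) = b"
  by (simp add: psnd_def)

definition pairs :: "'u::set_universe set \<Rightarrow> 'u set \<Rightarrow> 'u set" where
  "pairs A B = (\<Union>a\<in>A. pair a ` B)"

lemma pair_in_pairs [simp]: "pair a b \<in> pairs A B \<longleftrightarrow> a \<in> A \<and> b \<in> B"
  by (auto simp: pairs_def)

lemma pairsE:
  assumes "p \<in> pairs A B"
  obtains a b where "p = pair a b" "a \<in> A" "b \<in> B"
  using assms by (auto simp: pairs_def)

lemma small_pairs: "small A \<Longrightarrow> small B \<Longrightarrow> small (pairs A B)"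
  unfolding pairs_def by (intro small_UN small_image)

abbreviation proj1 :: "'u::set_universe set \<Rightarrow> 'u set \<Rightarrow> 'u \<Rightarrow> 'u" where
  "proj1 A B \<equiv> \<lambda>p\<in>pairs A B. pfst p"

abbreviation proj2 :: "'u::set_universe set \<Rightarrow> 'u set \<Rightarrow> 'u \<Rightarrow> 'u" where
  "proj2 A B \<equiv> \<lambda>p\<in>pairs A B. psnd p"

lemma compose_pairing:
  assumes "f \<in> Z \<rightarrow>\<^sub>E A" "g \<in> Z \<rightarrow>\<^sub>E B"
  shows "compose Z (proj1 A B) (\<lambda>z\<in>Z. pair (f z) (g z)) = f"
    and "compose Z (proj2 A B) (\<lambda>z\<in>Z. pair (f z) (g z)) = g"
  using assms by (auto simp: compose_def fun_eq_iff PiE_iff extensional_def)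

definition graph_code :: "'u::set_universe set \<Rightarrow> ('u \<Rightarrow> 'u) \<Rightarrow> 'u" where
  "graph_code X f = code ((\<lambda>x. pair x (f x)) ` X)"

definition app :: "'u::set_universe \<Rightarrow> 'u \<Rightarrow> 'u" where
  "app \<phi> x = (THE y. pair x y \<in> elts \<phi>)"

lemma app_graph_code: "small X \<Longrightarrow> x \<in> X \<Longrightarrow> app (graph_code X f) x = f x"
  by (auto simp: app_def graph_code_def elts_code small_image image_iff)

lemma graph_code_cong: "(\<And>x. x \<in> X \<Longrightarrow> f x = g x) \<Longrightarrow> graph_code X f = graph_code X g"
  by (simp add: graph_code_def cong: image_cong_simp)

lemma small_graph_codes:
  assumes "small X" "small Y" "F \<subseteq> X \<rightarrow>\<^sub>E Y"
  shows "small (graph_code X ` F)"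
proof (rule small_subset)
  show "small {x. elts x \<subseteq> pairs X Y}"
    using power small_pairs[OF assms(1,2)] by (auto simp: small_def)
  show "graph_code X ` F \<subseteq> {x. elts x \<subseteq> pairs X Y}"
    using assms by (fastforce simp: graph_code_def elts_code small_image)
qed

fun num :: "nat \<Rightarrow> 'u::set_universe" where
  "num 0 = code {}"
| "num (Suc n) = code {num n}"

lemma num_eq_iff [simp]: "num m = num n \<longleftrightarrow> m = n"
proof (induction m arbitrary: n)
  case 0
  show ?case by (cases n) (auto simp: code_eq_iff)
next
  case (Suc m)
  then show ?case by (cases n) (auto simp: code_eq_iff)
qed

section \<open>Products in categories of structured sets\<close>

text \<open>
  Spaces and quasi-spaces both form categories whose morphisms are functions between underlying
  sets \<open>U A\<close>; in such a category the universal property of the set of pairs only leaves the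
  pairing of two morphisms to be checked.
\<close>

lemma is_product_pairs:
  assumes hom: "\<And>A B. Hom K A B \<subseteq> U A \<rightarrow>\<^sub>E U B"
    and comp: "\<And>A B C g f. Comp K A B C g f = compose (U A) g f"
    and obj: "A \<in> Obj K" "B \<in> Obj K" "P \<in> Obj K"
    and pts: "U P = pairs (U A) (U B)"
    and proj: "proj1 (U A) (U B) \<in> Hom K P A" "proj2 (U A) (U B) \<in> Hom K P B"
    and pairing: "\<And>Z f g. Z \<in> Obj K \<Longrightarrow> f \<in> Hom K Z A \<Longrightarrow> g \<in> Hom K Z B \<Longrightarrow>
                    (\<lambda>z\<in>U Z. pair (f z) (g z)) \<in> Hom K Z P"
  shows "is_product K A B P (proj1 (U A) (U B)) (proj2 (U A) (U B))"
  unfolding is_product_def comp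
proof (intro conjI ballI obj proj)
  fix Z f g assume Z: "Z \<in> Obj K" and f: "f \<in> Hom K Z A" and g: "g \<in> Hom K Z B"
  have fg: "f \<in> U Z \<rightarrow>\<^sub>E U A" "g \<in> U Z \<rightarrow>\<^sub>E U B"
    using hom f g by blast+
  show "\<exists>!u. u \<in> Hom K Z P \<and> compose (U Z) (proj1 (U A) (U B)) u = f \<and>
             compose (U Z) (proj2 (U A) (U B)) u = g"
  proof (rule ex1I[of _ "\<lambda>z\<in>U Z. pair (f z) (g z)"])
    show "(\<lambda>z\<in>U Z. pair (f z) (g z)) \<in> Hom K Z P \<and>
          compose (U Z) (proj1 (U A) (U B)) (\<lambda>z\<in>U Z. pair (f z) (g z)) = f \<and>
          compose (U Z) (proj2 (U A) (U B)) (\<lambda>z\<in>U Z. pair (f z) (g z)) = g"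
      using pairing[OF Z f g] compose_pairing[OF fg] by blast
  next
    fix u assume u: "u \<in> Hom K Z P \<and> compose (U Z) (proj1 (U A) (U B)) u = f \<and>
             compose (U Z) (proj2 (U A) (U B)) u = g"
    then have uE: "u \<in> U Z \<rightarrow>\<^sub>E pairs (U A) (U B)"
      using hom pts by blast
    show "u = (\<lambda>z\<in>U Z. pair (f z) (g z))"
    proof (rule extensionalityI[of _ "U Z"])
      fix z assume z: "z \<in> U Z"
      then have "u z \<in> pairs (U A) (U B)" using uE by auto
      then show "u z = (\<lambda>z\<in>U Z. pair (f z) (g z)) z"
        using u z by (auto simp: compose_def elim!: pairsE)
    qed (use uE in \<open>auto simp: PiE_iff\<close>)
  qed
qed

section \<open>Pointwise descriptions of spaces and continuity\<close>

lemma mult_bot [simp]: "u * bot = (bot :: 'v::comm_quantale)"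
  using mult_Sup[of u "{}"] by simp

lemma bot_mult [simp]: "bot * u = (bot :: 'v::comm_quantale)"
  using mult_bot[of u] by (simp only: mult.commute)

lemma mult_mono_quantale:
  assumes "a \<le> b" "c \<le> d"
  shows "a * c \<le> b * (d :: 'v::comm_quantale)"
proof -
  have right: "u * v \<le> u * w" if "v \<le> w" for u v w :: 'v
  proof -
    have "Sup {v, w} = w"
      using that by (simp add: sup.absorb2)
    then have "u * w = Sup ((*) u ` {v, w})"
      using mult_Sup[of u "{v, w}"] by simp
    then have "u * w = sup (u * v) (u * w)" by simp
    then show ?thesis by (metis sup.cobounded1)
  qed
  have "a * c \<le> a * d" by (rule right) fact
  also have "\<dots> \<le> b * d" using right[OF assms(1), of d] by (simp add: mult.commute)
  finally show ?thesis .
qed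

lemma vcomp_graph: "(s \<odot> vgraph X f) x z = (if x \<in> X then s (f x) z else bot)"
  unfolding vcomp_def vgraph_def
  by (rule antisym) (auto intro!: SUP_least intro: SUP_upper2[of "f x"])

lemma vid_apply: "vid X x y = (if x \<in> X \<and> x = y then 1 else bot)"
  by (simp add: vid_def vgraph_def)

lemma vcomp_le_iff: "(s \<odot> r) x z \<le> c \<longleftrightarrow> (\<forall>y. r x y * s y z \<le> c)"
  by (simp add: vcomp_def SUP_le_iff)

lemma vcomp_ge: "r x y * s y z \<le> (s \<odot> r) x z"
  unfolding vcomp_def by (rule SUP_upper) simp

lemma graph_vcomp_le_iff:
  "(vgraph X f \<odot> r) x z \<le> c \<longleftrightarrow> (\<forall>y\<in>X. f y = z \<longrightarrow> r x y \<le> c)"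
  by (auto simp: vcomp_le_iff vgraph_def)

locale lax_setting =
  fixes D :: "('u::set_universe, 'v::comm_quantale) monad_data"
  assumes setting: "is_setting D"
begin

abbreviation T :: "'u set \<Rightarrow> 'u set" where "T \<equiv> TSet D"
abbreviation Tm :: "'u set \<Rightarrow> 'u set \<Rightarrow> ('u \<Rightarrow> 'u) \<Rightarrow> 'u \<Rightarrow> 'u" where "Tm \<equiv> TMap D"
abbreviation Tr :: "'u set \<Rightarrow> 'u set \<Rightarrow> ('u \<Rightarrow> 'u \<Rightarrow> 'v) \<Rightarrow> 'u \<Rightarrow> 'u \<Rightarrow> 'v" where "Tr \<equiv> TRel D"
abbreviation continuous where "continuous \<equiv> continuous_maps D"

lemma monad: "is_monad SetCat T Tm (Unit D) (Mult D)"
  and lax: "is_flat_lax_extension D"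
  using setting by (auto simp: is_setting_def)

lemma functorial: "is_functor SetCat T Tm"
  using monad by (simp add: is_monad_def)

lemma small_T: "small X \<Longrightarrow> small (T X)"
  using functorial by (simp add: is_functor_def SetCat_def)

lemma Tm_PiE: "small X \<Longrightarrow> small Y \<Longrightarrow> f \<in> X \<rightarrow>\<^sub>E Y \<Longrightarrow> Tm X Y f \<in> T X \<rightarrow>\<^sub>E T Y"
  using functorial by (simp add: is_functor_def SetCat_def)

lemma Tm_in: "small X \<Longrightarrow> small Y \<Longrightarrow> f \<in> X \<rightarrow>\<^sub>E Y \<Longrightarrow> t \<in> T X \<Longrightarrow> Tm X Y f t \<in> T Y"
  using Tm_PiE by blast

lemma Tm_id: "small X \<Longrightarrow> t \<in> T X \<Longrightarrow> Tm X X (\<lambda>x\<in>X. x) t = t"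
  using functorial by (simp add: is_functor_def SetCat_def)

lemma Tm_compose:
  "small X \<Longrightarrow> small Y \<Longrightarrow> small Z \<Longrightarrow> f \<in> X \<rightarrow>\<^sub>E Y \<Longrightarrow> g \<in> Y \<rightarrow>\<^sub>E Z \<Longrightarrow> t \<in> T X \<Longrightarrow>
     Tm X Z (compose X g f) t = Tm Y Z g (Tm X Y f t)"
  using functorial by (simp add: is_functor_def SetCat_def compose_eq)

lemma Unit_in: "small X \<Longrightarrow> x \<in> X \<Longrightarrow> Unit D X x \<in> T X"
  using monad by (auto simp: is_monad_def SetCat_def)

lemma Mult_in: "small X \<Longrightarrow> t \<in> T (T X) \<Longrightarrow> Mult D X t \<in> T X"
  using monad by (auto simp: is_monad_def SetCat_def)

lemma Unit_natural:
  assumes "small X" "small Y" "f \<in> X \<rightarrow>\<^sub>E Y" "x \<in> X"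
  shows "Tm X Y f (Unit D X x) = Unit D Y (f x)"
proof -
  have "compose X (Tm X Y f) (Unit D X) = compose X (Unit D Y) f"
    using monad assms by (simp add: is_monad_def SetCat_def)
  from fun_cong[OF this, of x] show ?thesis
    using assms by (simp add: compose_eq)
qed

lemma Mult_natural:
  assumes "small X" "small Y" "f \<in> X \<rightarrow>\<^sub>E Y" "t \<in> T (T X)"
  shows "Tm X Y f (Mult D X t) = Mult D Y (Tm (T X) (T Y) (Tm X Y f) t)"
proof -
  have "compose (T (T X)) (Tm X Y f) (Mult D X) =
        compose (T (T X)) (Mult D Y) (Tm (T X) (T Y) (Tm X Y f))"
    using monad assms by (simp add: is_monad_def SetCat_def)
  from fun_cong[OF this, of t] show ?thesis
    using assms by (simp add: compose_eq)
qed

lemma Tr_vrel: "small X \<Longrightarrow> small Y \<Longrightarrow> r \<in> vrel X Y \<Longrightarrow> Tr X Y r \<in> vrel (T X) (T Y)"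
  using lax by (simp add: is_flat_lax_extension_def)

text \<open>
  The hypothesis says \<open>g \<cdot> r \<cdot> f\<^sup>\<circ> \<le> s\<close>. By lax functoriality, and since the extension agrees with
  the functor on maps and commutes with converses, \<open>Tg \<cdot> Tr \<cdot> (Tf)\<^sup>\<circ> \<le> Ts\<close>, which is the
  conclusion.
\<close>

lemma Tr_map_mono:
  assumes small: "small X" "small Y" "small X'" "small Y'"
    and r: "r \<in> vrel X Y" and s: "s \<in> vrel X' Y'"
    and f: "f \<in> X \<rightarrow>\<^sub>E X'" and g: "g \<in> Y \<rightarrow>\<^sub>E Y'"
    and le: "\<And>x y. x \<in> X \<Longrightarrow> y \<in> Y \<Longrightarrow> r x y \<le> s (f x) (g y)"
    and t: "t \<in> T X" and t': "t' \<in> T Y"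
  shows "Tr X Y r t t' \<le> Tr X' Y' s (Tm X X' f t) (Tm Y Y' g t')"
proof -
  let ?f = "vgraph X f :: 'u \<Rightarrow> 'u \<Rightarrow> 'v" and ?g = "vgraph Y g :: 'u \<Rightarrow> 'u \<Rightarrow> 'v"
  have rels: "?f \<in> vrel X X'" "vconv ?f \<in> vrel X' X" "?g \<in> vrel Y Y'"
    using f g by (auto simp: vrel_def vgraph_def vconv_def)
  have rf: "r \<odot> vconv ?f \<in> vrel X' Y"
    using r f by (auto simp: vrel_def vcomp_def vconv_def vgraph_def)
  have grf: "?g \<odot> (r \<odot> vconv ?f) \<in> vrel X' Y'"
    using rf g by (auto simp: vrel_def vcomp_def vgraph_def)
  have "?g \<odot> (r \<odot> vconv ?f) \<le> s"
    using le by (auto simp: le_fun_def graph_vcomp_le_iff vcomp_le_iff vconv_def vgraph_def)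
  then have "Tr X' Y' (?g \<odot> (r \<odot> vconv ?f)) \<le> Tr X' Y' s"
    using lax small s grf by (simp add: is_flat_lax_extension_def)
  moreover have "Tr Y Y' ?g \<odot> Tr X' Y (r \<odot> vconv ?f) \<le> Tr X' Y' (?g \<odot> (r \<odot> vconv ?f))"
    using lax small rf rels unfolding is_flat_lax_extension_def by blast
  moreover have "Tr X Y r \<odot> Tr X' X (vconv ?f) \<le> Tr X' Y (r \<odot> vconv ?f)"
    using lax small r rels unfolding is_flat_lax_extension_def by blast
  moreover have "Tr X' X (vconv ?f) = vconv (vgraph (T X) (Tm X X' f))"
    and "Tr Y Y' ?g = vgraph (T Y) (Tm Y Y' g)"
    using lax small rels f g by (simp_all add: is_flat_lax_extension_def)
  ultimately have
    1: "(Tr X Y r \<odot> vconv (vgraph (T X) (Tm X X' f))) a b \<le> Tr X' Y (r \<odot> vconv ?f) a b" and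
    2: "(vgraph (T Y) (Tm Y Y' g) \<odot> Tr X' Y (r \<odot> vconv ?f)) a c \<le> Tr X' Y' s a c" for a b c
    by (simp_all add: le_fun_def) (meson order_trans)
  have "Tr X Y r t t' \<le> (Tr X Y r \<odot> vconv (vgraph (T X) (Tm X X' f))) (Tm X X' f t) t'"
    using vcomp_ge[of "vconv (vgraph (T X) (Tm X X' f))" "Tm X X' f t" t "Tr X Y r" t'] t
    by (simp add: vconv_def vgraph_def)
  also note 1
  also have "Tr X' Y (r \<odot> vconv ?f) (Tm X X' f t) t' \<le>
             (vgraph (T Y) (Tm Y Y' g) \<odot> Tr X' Y (r \<odot> vconv ?f)) (Tm X X' f t) (Tm Y Y' g t')"
    using vcomp_ge[of "Tr X' Y (r \<odot> vconv ?f)" "Tm X X' f t" t' "vgraph (T Y) (Tm Y Y' g)"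
        "Tm Y Y' g t'"] t'
    by (simp add: vgraph_def)
  also note 2
  finally show ?thesis .
qed

lemma is_space_iff:
  "is_space D A \<longleftrightarrow> small (points A) \<and> conv A \<in> vrel (T (points A)) (points A) \<and>
     (\<forall>x\<in>points A. 1 \<le> conv A (Unit D (points A) x) x) \<and>
     (\<forall>t\<in>T (T (points A)). \<forall>t'\<in>T (points A). \<forall>x\<in>points A.
        Tr (T (points A)) (points A) (conv A) t t' * conv A t' x \<le> conv A (Mult D (points A) t) x)"
  (is "?L \<longleftrightarrow> ?R")
proof (cases "small (points A) \<and> conv A \<in> vrel (T (points A)) (points A)")
  case True
  let ?X = "points A" and ?a = "conv A"
  have r: "Tr (T ?X) ?X ?a \<in> vrel (T (T ?X)) (T ?X)"
    using True by (simp add: Tr_vrel small_T)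
  have "vid ?X \<le> ?a \<odot> vgraph ?X (Unit D ?X) \<longleftrightarrow> (\<forall>x\<in>?X. 1 \<le> ?a (Unit D ?X x) x)"
    by (auto simp: le_fun_def vcomp_graph vid_apply)
  moreover have "?a \<odot> Tr (T ?X) ?X ?a \<le> ?a \<odot> vgraph (T (T ?X)) (Mult D ?X) \<longleftrightarrow>
     (\<forall>t\<in>T (T ?X). \<forall>t'\<in>T ?X. \<forall>x\<in>?X. Tr (T ?X) ?X ?a t t' * ?a t' x \<le> ?a (Mult D ?X t) x)"
    (is "?l \<longleftrightarrow> ?r")
  proof
    assume ?l
    then show ?r
      by (auto simp: le_fun_def vcomp_le_iff vcomp_graph split: if_splits)
  next
    assume ?r
    have "Tr (T ?X) ?X ?a t t' * ?a t' x \<le> (?a \<odot> vgraph (T (T ?X)) (Mult D ?X)) t x" for t t' x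
    proof (cases "t \<in> T (T ?X) \<and> t' \<in> T ?X \<and> x \<in> ?X")
      case True
      then show ?thesis using \<open>?r\<close> by (simp add: vcomp_graph)
    next
      case False
      then have "Tr (T ?X) ?X ?a t t' * ?a t' x = bot"
        using r True by (auto simp: vrel_def)
      then show ?thesis by simp
    qed
    then show ?l by (auto simp: le_fun_def vcomp_le_iff)
  qed
  ultimately show ?thesis
    using True by (simp add: is_space_def)
qed (auto simp: is_space_def)

lemma space_small: "is_space D A \<Longrightarrow> small (points A)"
  by (simp add: is_space_def)

lemma continuous_iff:
  assumes "is_space D A"
  shows "f \<in> continuous A B \<longleftrightarrow> f \<in> points A \<rightarrow>\<^sub>E points B \<and>
    (\<forall>t\<in>T (points A). \<forall>x\<in>points A. conv A t x \<le> conv B (Tm (points A) (points B) f t) (f x))"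
proof -
  have bot: "conv A t x = bot" if "t \<notin> T (points A)" for t x
    using assms that by (simp add: is_space_def vrel_def)
  show ?thesis
    unfolding continuous_maps_def
    by (auto simp: le_fun_def graph_vcomp_le_iff vcomp_graph bot)
qed

lemma continuous_PiE: "f \<in> continuous A B \<Longrightarrow> f \<in> points A \<rightarrow>\<^sub>E points B"
  by (simp add: continuous_maps_def)

lemma continuous_id: "is_space D A \<Longrightarrow> (\<lambda>x\<in>points A. x) \<in> continuous A A"
  by (auto simp: continuous_iff Tm_id space_small)

lemma continuous_compose:
  assumes A: "is_space D A" and B: "is_space D B" and C: "is_space D C"
    and f: "f \<in> continuous A B" and g: "g \<in> continuous B C"
  shows "compose (points A) g f \<in> continuous A C"
proof -
  note E = continuous_PiE[OF f] continuous_PiE[OF g]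
  have "conv A t x \<le> conv C (Tm (points A) (points C) (compose (points A) g f) t) (g (f x))"
    if tx: "t \<in> T (points A)" "x \<in> points A" for t x
  proof -
    have "conv A t x \<le> conv B (Tm (points A) (points B) f t) (f x)"
      using f A tx by (simp add: continuous_iff)
    also have "\<dots> \<le> conv C (Tm (points B) (points C) g (Tm (points A) (points B) f t)) (g (f x))"
      using g B tx E Tm_in[OF space_small[OF A] space_small[OF B] E(1)]
      by (auto simp: continuous_iff)
    also have "\<dots> = conv C (Tm (points A) (points C) (compose (points A) g f) t) (g (f x))"
      using E tx by (simp add: Tm_compose[of _ "points B"] space_small A B C)
    finally show ?thesis .
  qed
  then show ?thesis
    using E A by (auto simp: continuous_iff compose_eq compose_def)
qed

section \<open>Initial structures, products, equalizers and coproducts of spaces\<close>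

definition initial_space ::
  "'u set \<Rightarrow> (('u \<Rightarrow> 'u) \<times> ('u, 'v) tv_space) set \<Rightarrow> ('u, 'v) tv_space" where
  "initial_space X F = \<lparr>points = X,
     conv = (\<lambda>t x. if t \<in> T X \<and> x \<in> X
                    then INF (f, B)\<in>F. conv B (Tm X (points B) f t) (f x) else bot)\<rparr>"

lemma points_initial [simp]: "points (initial_space X F) = X"
  by (simp add: initial_space_def)

lemma conv_initial_le:
  assumes "(f, B) \<in> F" "t \<in> T X" "x \<in> X"
  shows "conv (initial_space X F) t x \<le> conv B (Tm X (points B) f t) (f x)"
  using assms by (auto simp: initial_space_def intro: INF_lower2)

lemma le_conv_initial:
  assumes "t \<in> T X" "x \<in> X" "\<And>f B. (f, B) \<in> F \<Longrightarrow> c \<le> conv B (Tm X (points B) f t) (f x)"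
  shows "c \<le> conv (initial_space X F) t x"
  using assms by (auto simp: initial_space_def intro: INF_greatest)

lemma is_space_initial:
  assumes X: "small X" and F: "\<And>f B. (f, B) \<in> F \<Longrightarrow> is_space D B \<and> f \<in> X \<rightarrow>\<^sub>E points B"
  shows "is_space D (initial_space X F)"
proof -
  let ?a = "conv (initial_space X F)"
  have rel: "?a \<in> vrel (T X) X"
    by (auto simp: initial_space_def vrel_def)
  have refl: "1 \<le> ?a (Unit D X x) x" if x: "x \<in> X" for x
  proof (rule le_conv_initial)
    fix f B assume "(f, B) \<in> F"
    then have B: "is_space D B" and f: "f \<in> X \<rightarrow>\<^sub>E points B" using F by auto
    then have "1 \<le> conv B (Unit D (points B) (f x)) (f x)"
      using x by (auto simp: is_space_iff)
    then show "1 \<le> conv B (Tm X (points B) f (Unit D X x)) (f x)"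
      by (simp add: Unit_natural X space_small[OF B] f x)
  qed (use x X Unit_in in auto)
  have trans: "Tr (T X) X ?a t t' * ?a t' x \<le> ?a (Mult D X t) x"
    if t: "t \<in> T (T X)" "t' \<in> T X" and x: "x \<in> X" for t t' x
  proof (rule le_conv_initial)
    fix f B assume FB: "(f, B) \<in> F"
    then have B: "is_space D B" and f: "f \<in> X \<rightarrow>\<^sub>E points B" using F by auto
    let ?Y = "points B" and ?b = "conv B"
    note sY = space_small[OF B]
    have TTf: "Tm (T X) (T ?Y) (Tm X ?Y f) t \<in> T (T ?Y)"
      by (intro Tm_in Tm_PiE small_T X sY f t)
    have "Tr (T X) X ?a t t' \<le> Tr (T ?Y) ?Y ?b (Tm (T X) (T ?Y) (Tm X ?Y f) t) (Tm X ?Y f t')"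
      using B by (intro Tr_map_mono small_T X sY rel Tm_PiE f t conv_initial_le FB)
        (auto simp: is_space_def)
    moreover have "?a t' x \<le> ?b (Tm X ?Y f t') (f x)"
      by (intro conv_initial_le FB t x)
    ultimately have "Tr (T X) X ?a t t' * ?a t' x \<le>
       Tr (T ?Y) ?Y ?b (Tm (T X) (T ?Y) (Tm X ?Y f) t) (Tm X ?Y f t') * ?b (Tm X ?Y f t') (f x)"
      by (rule mult_mono_quantale)
    also have "\<dots> \<le> ?b (Mult D ?Y (Tm (T X) (T ?Y) (Tm X ?Y f) t)) (f x)"
      using B TTf Tm_in[OF X sY f t(2)] PiE_mem[OF f x] by (simp add: is_space_iff)
    also have "\<dots> = ?b (Tm X ?Y f (Mult D X t)) (f x)"
      by (simp add: Mult_natural X sY f t)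
    finally show "Tr (T X) X ?a t t' * ?a t' x \<le> ?b (Tm X ?Y f (Mult D X t)) (f x)" .
  qed (use t x X Mult_in in auto)
  show ?thesis
    using X rel refl trans by (simp add: is_space_iff)
qed

lemma initial_member_continuous:
  assumes "small X" and "\<And>f B. (f, B) \<in> F \<Longrightarrow> is_space D B \<and> f \<in> X \<rightarrow>\<^sub>E points B" and "(f, B) \<in> F"
  shows "f \<in> continuous (initial_space X F) B"
  using assms conv_initial_le[OF assms(3)] by (simp add: continuous_iff is_space_initial)

lemma continuous_into_initial:
  assumes X: "small X" and F: "\<And>f B. (f, B) \<in> F \<Longrightarrow> is_space D B \<and> f \<in> X \<rightarrow>\<^sub>E points B"
    and Z: "is_space D Z" and g: "g \<in> points Z \<rightarrow>\<^sub>E X"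
    and cont: "\<And>f B. (f, B) \<in> F \<Longrightarrow> compose (points Z) f g \<in> continuous Z B"
  shows "g \<in> continuous Z (initial_space X F)"
proof -
  have "conv Z t x \<le> conv (initial_space X F) (Tm (points Z) X g t) (g x)"
    if tx: "t \<in> T (points Z)" "x \<in> points Z" for t x
  proof (rule le_conv_initial)
    fix f B assume FB: "(f, B) \<in> F"
    then have B: "is_space D B" and f: "f \<in> X \<rightarrow>\<^sub>E points B" using F by auto
    have "conv Z t x \<le> conv B (Tm (points Z) (points B) (compose (points Z) f g) t) (f (g x))"
      using cont[OF FB] tx Z by (simp add: continuous_iff compose_eq)
    then show "conv Z t x \<le> conv B (Tm X (points B) f (Tm (points Z) X g t)) (f (g x))"
      by (simp add: Tm_compose[of _ X] space_small Z B X g f tx)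
  qed (use tx g X Z Tm_in space_small in auto)
  then show ?thesis
    using g Z by (simp add: continuous_iff)
qed

lemma is_product_space:
  assumes A: "is_space D A" and B: "is_space D B"
  defines "p \<equiv> proj1 (points A) (points B)" and "q \<equiv> proj2 (points A) (points B)"
  shows "is_product (TVCat D) A B (initial_space (pairs (points A) (points B)) {(p, A), (q, B)}) p q"
proof -
  let ?X = "pairs (points A) (points B)" and ?F = "{(p, A), (q, B)}"
  have X: "small ?X" by (simp add: small_pairs space_small A B)
  have F: "is_space D C \<and> f \<in> ?X \<rightarrow>\<^sub>E points C" if "(f, C) \<in> ?F" for f C
    using that A B by (auto simp: p_def q_def elim!: pairsE)
  have pq: "p \<in> continuous (initial_space ?X ?F) A" "q \<in> continuous (initial_space ?X ?F) B"
    by (rule initial_member_continuous[OF X F]; simp)+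
  have P: "is_space D (initial_space ?X ?F)" by (rule is_space_initial[OF X F])
  have pairing: "(\<lambda>z\<in>points Z. pair (f z) (g z)) \<in> continuous Z (initial_space ?X ?F)"
    if Z: "is_space D Z" and fg: "f \<in> continuous Z A" "g \<in> continuous Z B" for Z f g
  proof (rule continuous_into_initial[OF X F Z])
    let ?u = "\<lambda>z\<in>points Z. pair (f z) (g z)"
    note E = fg[THEN continuous_PiE]
    show "?u \<in> points Z \<rightarrow>\<^sub>E ?X" using E by auto
    have "compose (points Z) p ?u = f" "compose (points Z) q ?u = g"
      unfolding p_def q_def using E by (simp_all add: compose_pairing)
    then show "compose (points Z) h ?u \<in> continuous Z C" if "(h, C) \<in> ?F" for h C
      using fg that by auto
  qed
  show ?thesis
    unfolding p_def q_def
    by (rule is_product_pairs[where U = points])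
      (use A B P pq pairing in \<open>simp_all add: TVCat_def continuous_PiE subsetI flip: p_def q_def\<close>)
qed

lemma is_equalizer_space:
  assumes A: "is_space D A" and B: "is_space D B"
    and fg: "f \<in> continuous A B" "g \<in> continuous A B"
  defines "X \<equiv> {x \<in> points A. f x = g x}"
  shows "is_equalizer (TVCat D) A B f g (initial_space X {(\<lambda>x\<in>X. x, A)}) (\<lambda>x\<in>X. x)"
proof -
  let ?i = "\<lambda>x\<in>X. x" and ?F = "{(\<lambda>x\<in>X. x, A)}"
  have X: "small X" by (rule small_subset[OF space_small[OF A]]) (auto simp: X_def)
  have F: "is_space D C \<and> h \<in> X \<rightarrow>\<^sub>E points C" if "(h, C) \<in> ?F" for h C
    using that A by (auto simp: X_def)
  have "\<exists>!u. u \<in> continuous Z (initial_space X ?F) \<and> compose (points Z) ?i u = h"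
    if Z: "is_space D Z" and h: "h \<in> continuous Z A"
      and eq: "compose (points Z) f h = compose (points Z) g h" for Z h
  proof (rule ex1I[of _ h])
    have "f (h z) = g (h z)" if "z \<in> points Z" for z
      using fun_cong[OF eq, of z] that by (simp add: compose_eq)
    then have E: "h \<in> points Z \<rightarrow>\<^sub>E X"
      using continuous_PiE[OF h] by (simp add: X_def PiE_iff)
    then have "compose (points Z) ?i h = h"
      by (auto simp: compose_def fun_eq_iff PiE_iff extensional_def)
    then show "h \<in> continuous Z (initial_space X ?F) \<and> compose (points Z) ?i h = h"
      using h E by (auto intro!: continuous_into_initial[OF X F Z])
    fix u assume u: "u \<in> continuous Z (initial_space X ?F) \<and> compose (points Z) ?i u = h"
    then have "u \<in> points Z \<rightarrow>\<^sub>E X" using continuous_PiE[of u] by fastforce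
    then have "compose (points Z) ?i u = u"
      by (auto simp: compose_def fun_eq_iff PiE_iff extensional_def)
    then show "u = h" using u by simp
  qed
  moreover have "?i \<in> continuous (initial_space X ?F) A"
    by (rule initial_member_continuous[OF X F]) auto
  moreover have "compose X f ?i = compose X g ?i"
    by (auto simp: compose_def X_def)
  moreover have "is_space D (initial_space X ?F)"
    by (rule is_space_initial[OF X F])
  ultimately show ?thesis
    using A B fg by (simp add: is_equalizer_def TVCat_def)
qed

text \<open>
  The coproduct carries the initial structure for all maps out of the disjoint union whose
  restrictions to the summands are continuous, so that its universal property is built in; the
  injections are continuous because all their composites with these maps are.
\<close>

lemma coproduct_exists:
  fixes I :: "nat set"
  assumes A: "\<And>i. i \<in> I \<Longrightarrow> is_space D (A i)"
  obtains S \<iota> where "is_coproduct (TVCat D) I A S \<iota>"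
proof -
  define X where "X = (\<Union>i\<in>I. pair (num i) ` points (A i))"
  define \<iota> where "\<iota> i = (\<lambda>x\<in>points (A i). pair (num i) x)" for i
  define F where "F = {(u, Z). is_space D Z \<and> u \<in> X \<rightarrow>\<^sub>E points Z \<and>
                          (\<forall>i\<in>I. compose (points (A i)) u (\<iota> i) \<in> continuous (A i) Z)}"
  let ?S = "initial_space X F"
  have X: "small X"
    unfolding X_def by (intro small_UN_nat small_image space_small A)
  have F: "is_space D Z \<and> u \<in> X \<rightarrow>\<^sub>E points Z" if "(u, Z) \<in> F" for u Z
    using that by (simp add: F_def)
  have S: "is_space D ?S" by (rule is_space_initial[OF X F])
  have \<iota>E: "\<iota> i \<in> points (A i) \<rightarrow>\<^sub>E X" if "i \<in> I" for i
    using that by (auto simp: \<iota>_def X_def)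
  have \<iota>: "\<iota> i \<in> continuous (A i) ?S" if "i \<in> I" for i
    by (rule continuous_into_initial[OF X F A \<iota>E]) (use that in \<open>auto simp: F_def\<close>)
  have "\<exists>!u. u \<in> continuous ?S Z \<and> (\<forall>i\<in>I. compose (points (A i)) u (\<iota> i) = f i)"
    if Z: "is_space D Z" and f: "\<forall>i\<in>I. f i \<in> continuous (A i) Z" for Z f
  proof -
    define u where "u = (\<lambda>s\<in>X. f (THE i. pfst s = num i) (psnd s))"
    have fE: "\<forall>i\<in>I. f i \<in> points (A i) \<rightarrow>\<^sub>E points Z"
      using f continuous_PiE by blast
    have eq: "compose (points (A i)) u (\<iota> i) = f i" if "i \<in> I" for i
      using fE that by (auto simp: compose_def u_def \<iota>_def X_def fun_eq_iff PiE_iff extensional_def)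
    have uE: "u \<in> X \<rightarrow>\<^sub>E points Z"
      using fE by (fastforce simp: u_def X_def)
    have "(u, Z) \<in> F" using uE Z f eq by (simp add: F_def)
    then have u: "u \<in> continuous ?S Z" by (intro initial_member_continuous[OF X F])
    show ?thesis
    proof (rule ex1I[of _ u])
      show "u \<in> continuous ?S Z \<and> (\<forall>i\<in>I. compose (points (A i)) u (\<iota> i) = f i)"
        using u eq by blast
      fix v assume v: "v \<in> continuous ?S Z \<and> (\<forall>i\<in>I. compose (points (A i)) v (\<iota> i) = f i)"
      show "v = u"
      proof (rule extensionalityI[of _ X])
        show "v \<in> extensional X" using v continuous_PiE[of v ?S Z] by (auto simp: PiE_iff)
        show "u \<in> extensional X" by (simp add: u_def)
        fix s assume "s \<in> X"
        then obtain i x where s: "i \<in> I" "x \<in> points (A i)" "s = pair (num i) x"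
          by (auto simp: X_def)
        then have "compose (points (A i)) v (\<iota> i) x = compose (points (A i)) u (\<iota> i) x"
          using v eq by simp
        then show "v s = u s" using s by (simp add: compose_def \<iota>_def)
      qed
    qed
  qed
  then have "is_coproduct (TVCat D) I A ?S \<iota>"
    using A S \<iota> by (simp add: is_coproduct_def TVCat_def)
  then show ?thesis by (rule that)
qed

text \<open>
  A point outside all images could be sent to either point of a two-point indiscrete space
  without changing the restrictions to the summands, against the uniqueness of induced maps.
\<close>

lemma coproduct_jointly_surjective:
  assumes S: "is_coproduct (TVCat D) I A S \<iota>" and s: "s \<in> points S"
  shows "\<exists>i\<in>I. \<exists>x\<in>points (A i). \<iota> i x = s"
proof (rule ccontr)
  assume "\<not> (\<exists>i\<in>I. \<exists>x\<in>points (A i). \<iota> i x = s)"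
  then have miss: "\<iota> i x \<noteq> s" if "i \<in> I" "x \<in> points (A i)" for i x
    using that by blast
  define a b where "a = (num 0 :: 'u)" and "b = (num 1 :: 'u)"
  have ab: "a \<noteq> b" by (simp add: a_def b_def del: num.simps)
  let ?Z = "initial_space {a, b} {}"
  have Z: "is_space D ?Z" by (rule is_space_initial) auto
  have spaces: "is_space D S" "\<And>i. i \<in> I \<Longrightarrow> is_space D (A i)"
    and \<iota>: "\<And>i. i \<in> I \<Longrightarrow> \<iota> i \<in> continuous (A i) S"
    using S by (auto simp: is_coproduct_def TVCat_def)
  have indiscrete: "f \<in> continuous B ?Z" if "f \<in> points B \<rightarrow>\<^sub>E {a, b}" "is_space D B" for f B
    using that by (intro continuous_into_initial) auto
  define u where "u c = (\<lambda>x\<in>points S. if x = s then c else a)" for c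
  have uc: "u c \<in> continuous S ?Z" if "c \<in> {a, b}" for c
    using that spaces(1) by (intro indiscrete) (auto simp: u_def)
  have restr: "compose (points (A i)) (u c) (\<iota> i) = (\<lambda>x\<in>points (A i). a)" if "i \<in> I" for c i
    using miss that continuous_PiE[OF \<iota>[OF that]] by (auto simp: compose_def u_def fun_eq_iff)
  have "\<forall>i\<in>I. (\<lambda>x\<in>points (A i). a) \<in> continuous (A i) ?Z"
    using spaces(2) by (auto intro!: indiscrete)
  then have "\<exists>!v. v \<in> continuous S ?Z \<and>
      (\<forall>i\<in>I. compose (points (A i)) v (\<iota> i) = (\<lambda>x\<in>points (A i). a))"
    using S Z unfolding is_coproduct_def TVCat_def by simp
  then have "u a = u b"
    using uc[of a] uc[of b] restr by blast
  from fun_cong[OF this, of s] show False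
    using s ab by (simp add: u_def)
qed

lemma CompHaus_space: "C \<in> CompHaus D \<Longrightarrow> is_space D C"
  by (simp add: CompHaus_def)

section \<open>Quasi-spaces\<close>

abbreviation qcontinuous where "qcontinuous \<equiv> quasi_continuous_maps D"

lemma is_covered_iff:
  "is_covered D C \<alpha> I Cs \<alpha>s \<longleftrightarrow> (\<exists>S \<iota> \<eta>. is_coproduct (TVCat D) I Cs S \<iota> \<and>
     \<eta> \<in> continuous S C \<and> \<eta> ` points S = points C \<and>
     (\<forall>i\<in>I. \<alpha>s i = (\<lambda>x\<in>points (Cs i). \<alpha> (\<eta> (\<iota> i x)))))"
proof -
  have eq: "compose (points (Cs i)) (compose (points S) \<alpha> \<eta>) (\<iota> i) =
        (\<lambda>x\<in>points (Cs i). \<alpha> (\<eta> (\<iota> i x)))"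
    if "is_coproduct (TVCat D) I Cs S \<iota>" "i \<in> I" for S \<iota> \<eta> i
  proof -
    have "\<iota> i \<in> points (Cs i) \<rightarrow>\<^sub>E points S"
      using that by (intro continuous_PiE) (simp add: is_coproduct_def TVCat_def)
    then show ?thesis by (auto simp: compose_def fun_eq_iff)
  qed
  show ?thesis
    unfolding is_covered_def by (intro iff_exI conj_cong ball_cong refl) (simp add: eq eq_commute)
qed

lemma is_covered_self:
  assumes C: "is_space D C" and \<alpha>: "\<alpha> \<in> points C \<rightarrow>\<^sub>E X"
  shows "is_covered D C \<alpha> {0} (\<lambda>_. C) (\<lambda>_. \<alpha>)"
proof -
  let ?id = "\<lambda>x\<in>points C. x"
  have compose_id: "compose (points C) u ?id = u" if "u \<in> points C \<rightarrow>\<^sub>E Y" for u Y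
    using that by (auto simp: compose_def fun_eq_iff PiE_iff extensional_def)
  have "\<exists>!u. u \<in> continuous C Z \<and> compose (points C) u ?id = f"
    if "f \<in> continuous C Z" for Z f
    using that by (intro ex1I[of _ f]) (auto simp: compose_id[OF continuous_PiE])
  then have "is_coproduct (TVCat D) {0} (\<lambda>_. C) C (\<lambda>_. ?id)"
    using C by (simp add: is_coproduct_def TVCat_def continuous_id)
  moreover have "\<alpha> = (\<lambda>x\<in>points C. \<alpha> (?id (?id x)))"
    using \<alpha> by (auto simp: fun_eq_iff PiE_iff extensional_def)
  ultimately show ?thesis
    unfolding is_covered_iff using continuous_id[OF C]
    by (intro exI[of _ C] exI[of _ "\<lambda>_. ?id"] exI[of _ ?id]) auto
qed

lemma is_covered_compose:
  assumes "is_covered D C \<alpha> I Cs \<alpha>s"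
  shows "is_covered D C (compose (points C) f \<alpha>) I Cs (\<lambda>i. compose (points (Cs i)) f (\<alpha>s i))"
proof -
  obtain S \<iota> \<eta> where S: "is_coproduct (TVCat D) I Cs S \<iota>" and \<eta>: "\<eta> \<in> continuous S C"
    "\<eta> ` points S = points C" and \<alpha>s: "\<forall>i\<in>I. \<alpha>s i = (\<lambda>x\<in>points (Cs i). \<alpha> (\<eta> (\<iota> i x)))"
    using assms unfolding is_covered_iff by blast
  have \<iota>: "\<iota> i \<in> points (Cs i) \<rightarrow>\<^sub>E points S" if "i \<in> I" for i
    using that S by (intro continuous_PiE) (simp add: is_coproduct_def TVCat_def)
  have "compose (points (Cs i)) f (\<alpha>s i) =
        (\<lambda>x\<in>points (Cs i). compose (points C) f \<alpha> (\<eta> (\<iota> i x)))" if "i \<in> I" for i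
    using \<alpha>s \<eta>(2) \<iota>[OF that] that by (auto simp: compose_def fun_eq_iff PiE_iff)
  then show ?thesis
    unfolding is_covered_iff using S \<eta> by blast
qed

text \<open>
  Every map is covered by itself, so only the other half of (QS3), that a map covered by
  admissible maps is admissible, has to be verified.
\<close>

lemma is_quasi_spaceI:
  assumes small: "small (qpoints X)"
    and outside: "\<And>C. C \<notin> CompHaus D \<Longrightarrow> admissible X C = {}"
    and maps: "\<And>C. C \<in> CompHaus D \<Longrightarrow> admissible X C \<subseteq> points C \<rightarrow>\<^sub>E qpoints X"
    and const: "\<And>C x. C \<in> CompHaus D \<Longrightarrow> x \<in> qpoints X \<Longrightarrow> (\<lambda>c\<in>points C. x) \<in> admissible X C"
    and reparam: "\<And>C C' h \<alpha>. C \<in> CompHaus D \<Longrightarrow> C' \<in> CompHaus D \<Longrightarrow> h \<in> continuous C C' \<Longrightarrow>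
                    \<alpha> \<in> admissible X C' \<Longrightarrow> compose (points C) \<alpha> h \<in> admissible X C"
    and cover: "\<And>C \<alpha> I Cs \<alpha>s. C \<in> CompHaus D \<Longrightarrow> \<alpha> \<in> points C \<rightarrow>\<^sub>E qpoints X \<Longrightarrow> finite I \<Longrightarrow>
                  (\<And>i. i \<in> I \<Longrightarrow> Cs i \<in> CompHaus D) \<Longrightarrow>
                  (\<And>i. i \<in> I \<Longrightarrow> \<alpha>s i \<in> admissible X (Cs i)) \<Longrightarrow>
                  is_covered D C \<alpha> I Cs \<alpha>s \<Longrightarrow> \<alpha> \<in> admissible X C"
  shows "is_quasi_space D X"
proof -
  have qs3: "\<alpha> \<in> admissible X C \<longleftrightarrow>
        (\<exists>I Cs \<alpha>s. finite I \<and> (\<forall>i\<in>I. Cs i \<in> CompHaus D \<and> \<alpha>s i \<in> admissible X (Cs i)) \<and>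
           is_covered D C \<alpha> I Cs \<alpha>s)" (is "?l \<longleftrightarrow> ?r")
    if C: "C \<in> CompHaus D" and \<alpha>: "\<alpha> \<in> points C \<rightarrow>\<^sub>E qpoints X" for C \<alpha>
  proof
    assume ?l
    with C \<alpha> show ?r
      by (intro exI[of _ "{0}"] exI[of _ "\<lambda>_. C"] exI[of _ "\<lambda>_. \<alpha>"])
        (simp add: is_covered_self[OF CompHaus_space])
  next
    assume ?r
    then obtain I Cs \<alpha>s where "finite I" and "\<forall>i\<in>I. Cs i \<in> CompHaus D \<and> \<alpha>s i \<in> admissible X (Cs i)"
      and "is_covered D C \<alpha> I Cs \<alpha>s" by (elim exE conjE)
    then show ?l using cover[OF C \<alpha>, of I Cs \<alpha>s] by simp
  qed
  show ?thesis
    unfolding is_quasi_space_def constant_maps_def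
    by (intro conjI ballI allI impI small outside maps qs3) (use const in \<open>auto intro: reparam\<close>)
qed

context
  fixes X :: "('u, 'v) quasi_space"
  assumes X: "is_quasi_space D X"
begin

lemma quasi_small: "small (qpoints X)"
  using X by (simp add: is_quasi_space_def)

lemma admissible_PiE: "\<alpha> \<in> admissible X C \<Longrightarrow> \<alpha> \<in> points C \<rightarrow>\<^sub>E qpoints X"
proof -
  have "\<forall>C. C \<notin> CompHaus D \<longrightarrow> admissible X C = {}"
    "\<forall>C\<in>CompHaus D. admissible X C \<subseteq> points C \<rightarrow>\<^sub>E qpoints X"
    using X by (simp_all add: is_quasi_space_def)
  then show "\<alpha> \<in> admissible X C \<Longrightarrow> \<alpha> \<in> points C \<rightarrow>\<^sub>E qpoints X" by blast
qed

lemma admissible_const: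
  assumes "C \<in> CompHaus D" "x \<in> qpoints X"
  shows "(\<lambda>c\<in>points C. x) \<in> admissible X C"
proof -
  have "constant_maps (points C) (qpoints X) \<subseteq> admissible X C"
    using X assms(1) by (simp add: is_quasi_space_def)
  then show ?thesis using assms(2) by (auto simp: constant_maps_def)
qed

lemma admissible_reparam:
  "C \<in> CompHaus D \<Longrightarrow> C' \<in> CompHaus D \<Longrightarrow> h \<in> continuous C C' \<Longrightarrow> \<alpha> \<in> admissible X C' \<Longrightarrow>
     compose (points C) \<alpha> h \<in> admissible X C"
  using X by (simp add: is_quasi_space_def)

lemma admissible_cover:
  assumes "C \<in> CompHaus D" "\<alpha> \<in> points C \<rightarrow>\<^sub>E qpoints X" "finite I"
    and "\<And>i. i \<in> I \<Longrightarrow> Cs i \<in> CompHaus D" "\<And>i. i \<in> I \<Longrightarrow> \<alpha>s i \<in> admissible X (Cs i)"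
    and "is_covered D C \<alpha> I Cs \<alpha>s"
  shows "\<alpha> \<in> admissible X C"
proof -
  have "\<alpha> \<in> admissible X C \<longleftrightarrow>
        (\<exists>I Cs \<alpha>s. finite I \<and> (\<forall>i\<in>I. Cs i \<in> CompHaus D \<and> \<alpha>s i \<in> admissible X (Cs i)) \<and>
           is_covered D C \<alpha> I Cs \<alpha>s)"
    using X assms(1,2) unfolding is_quasi_space_def by simp
  then show ?thesis using assms(3-6) by blast
qed

end

lemma qcontinuous_PiE: "f \<in> qcontinuous X Y \<Longrightarrow> f \<in> qpoints X \<rightarrow>\<^sub>E qpoints Y"
  by (simp add: quasi_continuous_maps_def)

lemma qcontinuous_admissible:
  "f \<in> qcontinuous X Y \<Longrightarrow> C \<in> CompHaus D \<Longrightarrow> \<alpha> \<in> admissible X C \<Longrightarrow>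
     compose (points C) f \<alpha> \<in> admissible Y C"
  by (simp add: quasi_continuous_maps_def)

lemma compose_assoc_PiE:
  "h \<in> A \<rightarrow>\<^sub>E B \<Longrightarrow> compose A (compose B f g) h = compose A f (compose A g h)"
  by (auto simp: compose_def fun_eq_iff)

lemma qcontinuous_compose:
  assumes X: "is_quasi_space D X" and f: "f \<in> qcontinuous X Y" and g: "g \<in> qcontinuous Y Z"
  shows "compose (qpoints X) g f \<in> qcontinuous X Z"
proof -
  have "compose (points C) (compose (qpoints X) g f) \<alpha> \<in> admissible Z C"
    if C: "C \<in> CompHaus D" and \<alpha>: "\<alpha> \<in> admissible X C" for C \<alpha>
    using qcontinuous_admissible[OF g C qcontinuous_admissible[OF f C \<alpha>]]
    by (simp add: compose_assoc_PiE[OF admissible_PiE[OF X \<alpha>]])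
  then show ?thesis
    using qcontinuous_PiE[OF f] qcontinuous_PiE[OF g]
    by (auto simp: quasi_continuous_maps_def compose_def)
qed

lemma qcontinuous_id:
  assumes X: "is_quasi_space D X"
  shows "(\<lambda>x\<in>qpoints X. x) \<in> qcontinuous X X"
proof -
  have "compose (points C) (\<lambda>x\<in>qpoints X. x) \<alpha> = \<alpha>" if "\<alpha> \<in> admissible X C" for C \<alpha>
    using admissible_PiE[OF X that] by (auto simp: compose_def fun_eq_iff PiE_iff extensional_def)
  then show ?thesis by (simp add: quasi_continuous_maps_def)
qed

lemma is_category_QsCat: "is_category (QsCat D)"
proof -
  have "compose (qpoints X) f (\<lambda>x\<in>qpoints X. x) = f \<and> compose (qpoints X) (\<lambda>y\<in>qpoints Y. y) f = f"
    if "f \<in> qcontinuous X Y" for f X Y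
    using qcontinuous_PiE[OF that] by (auto simp: compose_def fun_eq_iff PiE_iff extensional_def)
  moreover have "compose (qpoints X) (compose (qpoints Y) h g) f =
      compose (qpoints X) h (compose (qpoints X) g f)"
    if "f \<in> qcontinuous X Y" for f g X Y and h :: "'u \<Rightarrow> 'u"
    by (rule compose_assoc_PiE[OF qcontinuous_PiE[OF that]])
  ultimately show ?thesis
    by (simp add: is_category_def QsCat_def qcontinuous_id qcontinuous_compose)
qed

section \<open>Initial quasi-spaces, terminal object and products\<close>

definition initial_quasi ::
  "'u set \<Rightarrow> (('u \<Rightarrow> 'u) \<times> ('u, 'v) quasi_space) set \<Rightarrow> ('u, 'v) quasi_space" where
  "initial_quasi X F = \<lparr>qpoints = X,
     admissible = (\<lambda>C. if C \<in> CompHaus D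
       then {\<alpha> \<in> points C \<rightarrow>\<^sub>E X. \<forall>(f, B)\<in>F. compose (points C) f \<alpha> \<in> admissible B C} else {})\<rparr>"

lemma qpoints_initial [simp]: "qpoints (initial_quasi X F) = X"
  by (simp add: initial_quasi_def)

lemma admissible_initial:
  "C \<in> CompHaus D \<Longrightarrow> \<alpha> \<in> admissible (initial_quasi X F) C \<longleftrightarrow> \<alpha> \<in> points C \<rightarrow>\<^sub>E X \<and>
     (\<forall>f B. (f, B) \<in> F \<longrightarrow> compose (points C) f \<alpha> \<in> admissible B C)"
  by (auto simp: initial_quasi_def)

lemma is_quasi_space_initial:
  assumes X: "small X" and F: "\<And>f B. (f, B) \<in> F \<Longrightarrow> is_quasi_space D B \<and> f \<in> X \<rightarrow>\<^sub>E qpoints B"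
  shows "is_quasi_space D (initial_quasi X F)"
proof (rule is_quasi_spaceI)
  fix C assume "C \<notin> CompHaus D"
  then show "admissible (initial_quasi X F) C = {}" by (simp add: initial_quasi_def)
next
  fix C x assume C: "C \<in> CompHaus D" and x: "x \<in> qpoints (initial_quasi X F)"
  have "compose (points C) f (\<lambda>c\<in>points C. x) = (\<lambda>c\<in>points C. f x)" for f :: "'u \<Rightarrow> 'u"
    by (auto simp: compose_def)
  then show "(\<lambda>c\<in>points C. x) \<in> admissible (initial_quasi X F) C"
    using x F by (fastforce simp: admissible_initial[OF C] intro: admissible_const[OF _ C])
next
  fix C C' h \<alpha>
  assume C: "C \<in> CompHaus D" "C' \<in> CompHaus D" and h: "h \<in> continuous C C'"
    and \<alpha>: "\<alpha> \<in> admissible (initial_quasi X F) C'"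
  have "compose (points C) f (compose (points C) \<alpha> h) \<in> admissible B C" if "(f, B) \<in> F" for f B
    using admissible_reparam[of B C C' h "compose (points C') f \<alpha>"] F[OF that] C h \<alpha> that
    by (simp add: compose_assoc_PiE[OF continuous_PiE[OF h]] admissible_initial)
  moreover have "compose (points C) \<alpha> h \<in> points C \<rightarrow>\<^sub>E X"
    using \<alpha> continuous_PiE[OF h] C by (auto simp: admissible_initial compose_def)
  ultimately show "compose (points C) \<alpha> h \<in> admissible (initial_quasi X F) C"
    using C by (simp add: admissible_initial)
next
  fix C \<alpha> Cs \<alpha>s and I :: "nat set"
  assume C: "C \<in> CompHaus D" and \<alpha>: "\<alpha> \<in> points C \<rightarrow>\<^sub>E qpoints (initial_quasi X F)"
    and I: "finite I" and Cs: "\<And>i. i \<in> I \<Longrightarrow> Cs i \<in> CompHaus D"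
    and \<alpha>s: "\<And>i. i \<in> I \<Longrightarrow> \<alpha>s i \<in> admissible (initial_quasi X F) (Cs i)"
    and cover: "is_covered D C \<alpha> I Cs \<alpha>s"
  have "compose (points C) f \<alpha> \<in> admissible B C" if FB: "(f, B) \<in> F" for f B
  proof (rule admissible_cover[OF _ C _ I])
    show "is_covered D C (compose (points C) f \<alpha>) I Cs (\<lambda>i. compose (points (Cs i)) f (\<alpha>s i))"
      by (rule is_covered_compose[OF cover])
    show "compose (points (Cs i)) f (\<alpha>s i) \<in> admissible B (Cs i)" if "i \<in> I" for i
      using \<alpha>s[OF that] Cs[OF that] FB by (simp add: admissible_initial)
    show "compose (points C) f \<alpha> \<in> points C \<rightarrow>\<^sub>E qpoints B"
      using F[OF FB] \<alpha> by (auto simp: compose_def)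
  qed (use F[OF FB] Cs in auto)
  then show "\<alpha> \<in> admissible (initial_quasi X F) C"
    using \<alpha> C by (simp add: admissible_initial)
qed (use X admissible_initial in auto)

lemma qcontinuous_into_initial:
  assumes Z: "is_quasi_space D Z" and g: "g \<in> qpoints Z \<rightarrow>\<^sub>E X"
    and F: "\<And>f B. (f, B) \<in> F \<Longrightarrow> compose (qpoints Z) f g \<in> qcontinuous Z B"
  shows "g \<in> qcontinuous Z (initial_quasi X F)"
proof -
  have "compose (points C) g \<alpha> \<in> admissible (initial_quasi X F) C"
    if C: "C \<in> CompHaus D" and \<alpha>: "\<alpha> \<in> admissible Z C" for C \<alpha>
  proof -
    note E = admissible_PiE[OF Z \<alpha>]
    have "compose (points C) f (compose (points C) g \<alpha>) \<in> admissible B C" if "(f, B) \<in> F" for f B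
      using qcontinuous_admissible[OF F[OF that] C \<alpha>] by (simp add: compose_assoc_PiE[OF E])
    moreover have "compose (points C) g \<alpha> \<in> points C \<rightarrow>\<^sub>E X"
      using g E by (auto simp: compose_def)
    ultimately show ?thesis by (simp add: admissible_initial[OF C])
  qed
  then show ?thesis
    using g by (simp add: quasi_continuous_maps_def)
qed

lemma initial_member_qcontinuous:
  assumes "(f, B) \<in> F" "f \<in> X \<rightarrow>\<^sub>E qpoints B"
  shows "f \<in> qcontinuous (initial_quasi X F) B"
  using assms by (auto simp: quasi_continuous_maps_def admissible_initial)

lemma is_terminal_QsCat: "is_terminal (QsCat D) (initial_quasi {x} {})"
proof -
  have "\<exists>!f. f \<in> qcontinuous A (initial_quasi {x} {})" if A: "is_quasi_space D A" for A
  proof (rule ex1I[of _ "\<lambda>a\<in>qpoints A. x"])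
    show "(\<lambda>a\<in>qpoints A. x) \<in> qcontinuous A (initial_quasi {x} {})"
      by (intro qcontinuous_into_initial A) auto
    show "f = (\<lambda>a\<in>qpoints A. x)" if "f \<in> qcontinuous A (initial_quasi {x} {})" for f
      using qcontinuous_PiE[OF that] by (auto simp: fun_eq_iff PiE_iff extensional_def)
  qed
  moreover have "is_quasi_space D (initial_quasi {x} {})"
    by (rule is_quasi_space_initial) auto
  ultimately show ?thesis
    by (simp add: is_terminal_def QsCat_def)
qed

definition qproduct :: "('u, 'v) quasi_space \<Rightarrow> ('u, 'v) quasi_space \<Rightarrow> ('u, 'v) quasi_space" where
  "qproduct A B = initial_quasi (pairs (qpoints A) (qpoints B))
     {(proj1 (qpoints A) (qpoints B), A), (proj2 (qpoints A) (qpoints B), B)}"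

lemma qpoints_qproduct [simp]: "qpoints (qproduct A B) = pairs (qpoints A) (qpoints B)"
  by (simp add: qproduct_def)

lemma proj_PiE: "proj1 A B \<in> pairs A B \<rightarrow>\<^sub>E A" "proj2 A B \<in> pairs A B \<rightarrow>\<^sub>E B"
  by (auto elim!: pairsE)

lemma is_quasi_space_qproduct:
  "is_quasi_space D A \<Longrightarrow> is_quasi_space D B \<Longrightarrow> is_quasi_space D (qproduct A B)"
  unfolding qproduct_def
  by (intro is_quasi_space_initial small_pairs quasi_small) (auto simp: elim!: pairsE)

lemma admissible_pairing:
  assumes C: "C \<in> CompHaus D" and A: "is_quasi_space D A" and B: "is_quasi_space D B"
    and \<alpha>: "\<alpha> \<in> admissible A C" and \<beta>: "\<beta> \<in> admissible B C"
  shows "(\<lambda>c\<in>points C. pair (\<alpha> c) (\<beta> c)) \<in> admissible (qproduct A B) C"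
proof -
  note E = admissible_PiE[OF A \<alpha>] admissible_PiE[OF B \<beta>]
  have "(\<lambda>c\<in>points C. pair (\<alpha> c) (\<beta> c)) \<in> points C \<rightarrow>\<^sub>E pairs (qpoints A) (qpoints B)"
    using E by auto
  then show ?thesis
    using \<alpha> \<beta> compose_pairing[OF E] unfolding qproduct_def admissible_initial[OF C] by auto
qed

lemma qcontinuous_pairing:
  assumes Z: "is_quasi_space D Z" and f: "f \<in> qcontinuous Z A" and g: "g \<in> qcontinuous Z B"
  shows "(\<lambda>z\<in>qpoints Z. pair (f z) (g z)) \<in> qcontinuous Z (qproduct A B)"
  unfolding qproduct_def
proof (rule qcontinuous_into_initial[OF Z])
  note E = qcontinuous_PiE[OF f] qcontinuous_PiE[OF g]
  show "(\<lambda>z\<in>qpoints Z. pair (f z) (g z)) \<in> qpoints Z \<rightarrow>\<^sub>E pairs (qpoints A) (qpoints B)"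
    using E by auto
  show "compose (qpoints Z) h (\<lambda>z\<in>qpoints Z. pair (f z) (g z)) \<in> qcontinuous Z C"
    if "(h, C) \<in> {(proj1 (qpoints A) (qpoints B), A), (proj2 (qpoints A) (qpoints B), B)}" for h C
    using that f g compose_pairing[OF E] by auto
qed

lemma is_product_QsCat:
  assumes A: "is_quasi_space D A" and B: "is_quasi_space D B"
  shows "is_product (QsCat D) A B (qproduct A B)
           (proj1 (qpoints A) (qpoints B)) (proj2 (qpoints A) (qpoints B))"
proof (rule is_product_pairs[where U = qpoints])
  fix Z f g assume "Z \<in> Obj (QsCat D)" and "f \<in> Hom (QsCat D) Z A" "g \<in> Hom (QsCat D) Z B"
  then show "(\<lambda>z\<in>qpoints Z. pair (f z) (g z)) \<in> Hom (QsCat D) Z (qproduct A B)"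
    by (simp add: QsCat_def qcontinuous_pairing)
next
  show "proj1 (qpoints A) (qpoints B) \<in> Hom (QsCat D) (qproduct A B) A"
    "proj2 (qpoints A) (qpoints B) \<in> Hom (QsCat D) (qproduct A B) B"
    unfolding QsCat_def qproduct_def category.simps
    by (intro initial_member_qcontinuous proj_PiE insertI1 insertI2)+
qed (use A B in \<open>simp_all add: QsCat_def is_quasi_space_qproduct qcontinuous_PiE subsetI\<close>)

lemma QsCat_productD:
  assumes "is_product (QsCat D) A B P p q"
  shows "is_quasi_space D A" "is_quasi_space D B" "is_quasi_space D P"
    and "p \<in> qcontinuous P A" "q \<in> qcontinuous P B"
    and "is_quasi_space D Z \<Longrightarrow> f \<in> qcontinuous Z A \<Longrightarrow> g \<in> qcontinuous Z B \<Longrightarrow>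
      \<exists>!u. u \<in> qcontinuous Z P \<and> compose (qpoints Z) p u = f \<and> compose (qpoints Z) q u = g"
  using assms by (simp_all add: is_product_def QsCat_def)

text \<open>
  The universal property of an exponential quantifies over all products \<open>R\<close> of \<open>Z\<close> and \<open>A\<close>; the
  isomorphism \<open>w\<close> with the product of pairs allows morphisms out of \<open>R\<close> to be transposed.
\<close>

lemma product_comparison:
  assumes R_prod: "is_product (QsCat D) Z A R p q"
  obtains w where "w \<in> qcontinuous (qproduct Z A) R"
    and "\<And>z a. z \<in> qpoints Z \<Longrightarrow> a \<in> qpoints A \<Longrightarrow> p (w (pair z a)) = z"
    and "\<And>z a. z \<in> qpoints Z \<Longrightarrow> a \<in> qpoints A \<Longrightarrow> q (w (pair z a)) = a"
    and "\<And>r. r \<in> qpoints R \<Longrightarrow> w (pair (p r) (q r)) = r"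
proof -
  note Z = QsCat_productD(1)[OF R_prod] and A = QsCat_productD(2)[OF R_prod]
    and R = QsCat_productD(3)[OF R_prod]
    and p = QsCat_productD(4)[OF R_prod] and q = QsCat_productD(5)[OF R_prod]
  note pE = qcontinuous_PiE[OF p] and qE = qcontinuous_PiE[OF q]
  note canon = is_product_QsCat[OF Z A]
  obtain w where w: "w \<in> qcontinuous (qproduct Z A) R"
    and w1: "compose (qpoints (qproduct Z A)) p w = proj1 (qpoints Z) (qpoints A)"
    and w2: "compose (qpoints (qproduct Z A)) q w = proj2 (qpoints Z) (qpoints A)"
    using QsCat_productD(6)[OF R_prod QsCat_productD(3,4,5)[OF canon]] by blast
  have pw: "p (w (pair z a)) = z" and qw: "q (w (pair z a)) = a"
    if "z \<in> qpoints Z" "a \<in> qpoints A" for z a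
    using fun_cong[OF w1, of "pair z a"] fun_cong[OF w2, of "pair z a"] that
    by (simp_all add: compose_eq)
  let ?v = "\<lambda>r\<in>qpoints R. pair (p r) (q r)"
  have "?v \<in> qcontinuous R (qproduct Z A)"
    by (rule qcontinuous_pairing[OF R p q])
  then have wv: "compose (qpoints R) w ?v \<in> qcontinuous R R"
    by (rule qcontinuous_compose[OF R _ w])
  have wv1: "compose (qpoints R) p (compose (qpoints R) w ?v) = p"
    and wv2: "compose (qpoints R) q (compose (qpoints R) w ?v) = q"
    using PiE_arb[OF pE] PiE_arb[OF qE] PiE_mem[OF pE] PiE_mem[OF qE]
    by (simp_all add: fun_eq_iff compose_def pw qw)
  have id1: "compose (qpoints R) p (\<lambda>r\<in>qpoints R. r) = p"
    and id2: "compose (qpoints R) q (\<lambda>r\<in>qpoints R. r) = q"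
    using PiE_arb[OF pE] PiE_arb[OF qE] by (simp_all add: fun_eq_iff compose_def)
  have wv_id: "compose (qpoints R) w ?v = (\<lambda>r\<in>qpoints R. r)"
    using QsCat_productD(6)[OF R_prod R p q] conjI[OF wv conjI[OF wv1 wv2]]
      conjI[OF qcontinuous_id[OF R] conjI[OF id1 id2]] by (elim ex1E) metis
  have wpq: "w (pair (p r) (q r)) = r" if "r \<in> qpoints R" for r
    using fun_cong[OF wv_id, of r] that by (simp add: compose_eq)
  show ?thesis by (rule that[OF w pw qw wpq])
qed

end

section \<open>Exponentials\<close>

locale closed_setting = lax_setting D
  for D :: "('u::set_universe, 'v::comm_quantale) monad_data" +
  assumes closed: "CompHaus_closed D"
begin

lemma pullback_exists:
  assumes A: "A \<in> CompHaus D" and B: "B \<in> CompHaus D" and C: "C \<in> CompHaus D"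
    and f: "f \<in> continuous A C" and g: "g \<in> continuous B C"
  obtains W p q where "W \<in> CompHaus D" "p \<in> continuous W A" "q \<in> continuous W B"
    and "\<And>w. w \<in> points W \<Longrightarrow> f (p w) = g (q w)"
    and "\<And>a b. a \<in> points A \<Longrightarrow> b \<in> points B \<Longrightarrow> f a = g b \<Longrightarrow> \<exists>w\<in>points W. p w = a \<and> q w = b"
proof -
  note spaces = A[THEN CompHaus_space] B[THEN CompHaus_space] C[THEN CompHaus_space]
  let ?p = "proj1 (points A) (points B)" and ?q = "proj2 (points A) (points B)"
  define P where "P = initial_space (pairs (points A) (points B)) {(?p, A), (?q, B)}"
  have prod: "is_product (TVCat D) A B P ?p ?q"
    unfolding P_def by (rule is_product_space[OF spaces(1,2)])
  have PC: "P \<in> CompHaus D"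
    using closed A B prod unfolding CompHaus_closed_def by blast
  note P = CompHaus_space[OF PC]
  have pq: "?p \<in> continuous P A" "?q \<in> continuous P B"
    using prod by (simp_all add: is_product_def TVCat_def)
  have ptsP: "points P = pairs (points A) (points B)" by (simp add: P_def)
  let ?f = "compose (points P) f ?p" and ?g = "compose (points P) g ?q"
  have fg: "?f \<in> continuous P C" "?g \<in> continuous P C"
    by (rule continuous_compose[OF P _ _ pq(1) f] continuous_compose[OF P _ _ pq(2) g]; rule spaces)+
  define X where "X = {x \<in> points P. ?f x = ?g x}"
  define W where "W = initial_space X {(\<lambda>x\<in>X. x, P)}"
  let ?i = "\<lambda>x\<in>X. x"
  have eq: "is_equalizer (TVCat D) P C ?f ?g W ?i"
    unfolding W_def X_def by (rule is_equalizer_space[OF P spaces(3) fg])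
  have WC: "W \<in> CompHaus D"
    using closed PC C eq unfolding CompHaus_closed_def by blast
  have i: "?i \<in> continuous W P"
    using eq by (simp add: is_equalizer_def TVCat_def)
  have ptsW: "points W = X" by (simp add: W_def)
  show ?thesis
  proof (rule that[OF WC])
    show "compose (points W) ?p ?i \<in> continuous W A" "compose (points W) ?q ?i \<in> continuous W B"
      by (intro continuous_compose[OF CompHaus_space[OF WC] P] spaces i pq)+
    show "f (compose (points W) ?p ?i w) = g (compose (points W) ?q ?i w)" if "w \<in> points W" for w
      using that by (auto simp: ptsW compose_def X_def ptsP)
    show "\<exists>w\<in>points W. compose (points W) ?p ?i w = a \<and> compose (points W) ?q ?i w = b"
      if "a \<in> points A" "b \<in> points B" "f a = g b" for a b
      using that by (intro bexI[of _ "pair a b"]) (auto simp: ptsW X_def ptsP compose_def)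
  qed
qed

text \<open>
  Testing a map \<open>\<alpha> : C \<rightarrow> B\<^sup>A\<close> against all \<open>h : C' \<rightarrow> C\<close> and admissible \<open>\<beta> : C' \<rightarrow> A\<close> makes
  (QS2) and the admissibility of evaluation immediate; it amounts to the admissibility of the
  transposes of \<open>\<alpha>\<close> on \<open>C \<times> C'\<close>, without mentioning products of spaces.
\<close>

definition qexp :: "('u, 'v) quasi_space \<Rightarrow> ('u, 'v) quasi_space \<Rightarrow> ('u, 'v) quasi_space" where
  "qexp A B = \<lparr>qpoints = graph_code (qpoints A) ` qcontinuous A B,
     admissible = (\<lambda>C. if C \<in> CompHaus D
       then {\<alpha> \<in> points C \<rightarrow>\<^sub>E graph_code (qpoints A) ` qcontinuous A B.
               \<forall>C'\<in>CompHaus D. \<forall>h\<in>continuous C' C. \<forall>\<beta>\<in>admissible A C'.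
                 (\<lambda>c\<in>points C'. app (\<alpha> (h c)) (\<beta> c)) \<in> admissible B C'}
       else {})\<rparr>"

lemma qpoints_qexp: "qpoints (qexp A B) = graph_code (qpoints A) ` qcontinuous A B"
  by (simp add: qexp_def)

lemma admissible_qexp_iff:
  "C \<in> CompHaus D \<Longrightarrow> \<alpha> \<in> admissible (qexp A B) C \<longleftrightarrow> \<alpha> \<in> points C \<rightarrow>\<^sub>E qpoints (qexp A B) \<and>
     (\<forall>C'\<in>CompHaus D. \<forall>h\<in>continuous C' C. \<forall>\<beta>\<in>admissible A C'.
        (\<lambda>c\<in>points C'. app (\<alpha> (h c)) (\<beta> c)) \<in> admissible B C')"
  by (simp add: qexp_def)

context
  fixes A B :: "('u, 'v) quasi_space"
  assumes A: "is_quasi_space D A" and B: "is_quasi_space D B"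
begin

lemma app_qexp_in: "\<phi> \<in> qpoints (qexp A B) \<Longrightarrow> a \<in> qpoints A \<Longrightarrow> app \<phi> a \<in> qpoints B"
  by (auto simp: qpoints_qexp app_graph_code quasi_small[OF A] dest: PiE_mem[OF qcontinuous_PiE])

lemma app_qexp_admissible:
  assumes \<phi>: "\<phi> \<in> qpoints (qexp A B)" and C: "C \<in> CompHaus D" and \<beta>: "\<beta> \<in> admissible A C"
  shows "(\<lambda>c\<in>points C. app \<phi> (\<beta> c)) \<in> admissible B C"
proof -
  obtain f where f: "f \<in> qcontinuous A B" "\<phi> = graph_code (qpoints A) f"
    using \<phi> by (auto simp: qpoints_qexp)
  have "(\<lambda>c\<in>points C. app \<phi> (\<beta> c)) = compose (points C) f \<beta>"
    using admissible_PiE[OF A \<beta>]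
    by (auto simp: f(2) compose_def app_graph_code quasi_small[OF A] fun_eq_iff dest: PiE_mem)
  then show ?thesis
    using qcontinuous_admissible[OF f(1) C \<beta>] by simp
qed

lemma qexp_eqI:
  assumes "\<phi> \<in> qpoints (qexp A B)" "\<And>a. a \<in> qpoints A \<Longrightarrow> app \<phi> a = f a"
  shows "\<phi> = graph_code (qpoints A) f"
  using assms quasi_small[OF A] by (auto simp: qpoints_qexp app_graph_code intro!: graph_code_cong)

text \<open>
  For (QS3), let \<open>\<alpha>\<close> be covered by maps \<open>\<alpha>\<^sub>i : C\<^sub>i \<rightarrow> B\<^sup>A\<close> along \<open>\<eta>\<close>. Given a test \<open>h : C' \<rightarrow> C\<close>,
  \<open>\<beta> : C' \<rightarrow> A\<close>, let \<open>W\<^sub>i\<close> be the pullback of \<open>h\<close> and \<open>\<eta> \<cdot> \<iota>\<^sub>i\<close>. The projections of the \<open>W\<^sub>i\<close> to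
  \<open>C'\<close> are jointly surjective because the maps \<open>\<eta> \<cdot> \<iota>\<^sub>i\<close> are, and the map to be tested is
  covered by its restrictions to the \<open>W\<^sub>i\<close>, which are tests of the \<open>\<alpha>\<^sub>i\<close>. Since (QS3) only asks
  for a surjection onto \<open>C'\<close>, this works whether or not coproducts are stable under pullback.
\<close>

lemma qexp_cover:
  assumes C: "C \<in> CompHaus D" and \<alpha>: "\<alpha> \<in> points C \<rightarrow>\<^sub>E qpoints (qexp A B)"
    and I: "finite I" and Cs: "\<And>i. i \<in> I \<Longrightarrow> Cs i \<in> CompHaus D"
    and \<alpha>s: "\<And>i. i \<in> I \<Longrightarrow> \<alpha>s i \<in> admissible (qexp A B) (Cs i)"
    and cover: "is_covered D C \<alpha> I Cs \<alpha>s"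
  shows "\<alpha> \<in> admissible (qexp A B) C"
  unfolding admissible_qexp_iff[OF C]
proof (intro conjI \<alpha> ballI)
  fix C' h \<beta>
  assume C': "C' \<in> CompHaus D" and h: "h \<in> continuous C' C" and \<beta>: "\<beta> \<in> admissible A C'"
  obtain S \<iota> \<eta> where S: "is_coproduct (TVCat D) I Cs S \<iota>" and \<eta>: "\<eta> \<in> continuous S C"
    "\<eta> ` points S = points C" and \<alpha>s_eq: "\<forall>i\<in>I. \<alpha>s i = (\<lambda>x\<in>points (Cs i). \<alpha> (\<eta> (\<iota> i x)))"
    using cover unfolding is_covered_iff by blast
  have \<iota>: "\<iota> i \<in> continuous (Cs i) S" if "i \<in> I" for i
    using S that by (simp add: is_coproduct_def TVCat_def)
  have S_space: "is_space D S"
    using S by (simp add: is_coproduct_def TVCat_def)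
  define k where "k i = compose (points (Cs i)) \<eta> (\<iota> i)" for i
  have k: "k i \<in> continuous (Cs i) C" if "i \<in> I" for i
    unfolding k_def by (intro continuous_compose[OF _ S_space] CompHaus_space Cs C \<iota> \<eta>(1) that)
  define pb where "pb i W p q \<longleftrightarrow>
      W \<in> CompHaus D \<and> p \<in> continuous W C' \<and> q \<in> continuous W (Cs i) \<and>
      (\<forall>w\<in>points W. h (p w) = k i (q w)) \<and>
      (\<forall>c\<in>points C'. \<forall>x\<in>points (Cs i). h c = k i x \<longrightarrow> (\<exists>w\<in>points W. p w = c \<and> q w = x))"
    for i W p q
  have "\<exists>W p q. pb i W p q" if i: "i \<in> I" for i
  proof (rule pullback_exists[OF C' Cs[OF i] C h k[OF i]])
    fix W p q
    assume "W \<in> CompHaus D" "p \<in> continuous W C'" "q \<in> continuous W (Cs i)"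
      and "\<And>w. w \<in> points W \<Longrightarrow> h (p w) = k i (q w)"
      and "\<And>c x. c \<in> points C' \<Longrightarrow> x \<in> points (Cs i) \<Longrightarrow> h c = k i x \<Longrightarrow>
             \<exists>w\<in>points W. p w = c \<and> q w = x"
    then have "pb i W p q" by (simp add: pb_def)
    then show ?thesis by blast
  qed
  then obtain W p q where pb: "\<And>i. i \<in> I \<Longrightarrow> pb i (W i) (p i) (q i)"
    by metis
  then have W: "W i \<in> CompHaus D" and p: "p i \<in> continuous (W i) C'"
    and q: "q i \<in> continuous (W i) (Cs i)"
    and square: "\<And>w. w \<in> points (W i) \<Longrightarrow> h (p i w) = k i (q i w)"
    and lift: "\<And>c x. c \<in> points C' \<Longrightarrow> x \<in> points (Cs i) \<Longrightarrow> h c = k i x \<Longrightarrow>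
                 \<exists>w\<in>points (W i). p i w = c \<and> q i w = x" if "i \<in> I" for i
    using that by (simp_all add: pb_def)
  obtain S' \<kappa> where S': "is_coproduct (TVCat D) I W S' \<kappa>"
    using coproduct_exists[of I W] W CompHaus_space by blast
  have \<kappa>: "\<kappa> i \<in> continuous (W i) S'" if "i \<in> I" for i
    using S' that by (simp add: is_coproduct_def TVCat_def)
  have "\<exists>!\<theta>. \<theta> \<in> continuous S' C' \<and> (\<forall>i\<in>I. compose (points (W i)) \<theta> (\<kappa> i) = p i)"
    using S' p CompHaus_space[OF C'] by (simp add: is_coproduct_def TVCat_def)
  then obtain \<theta> where \<theta>: "\<theta> \<in> continuous S' C'"
    and \<theta>p: "\<forall>i\<in>I. compose (points (W i)) \<theta> (\<kappa> i) = p i"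
    by blast
  have \<theta>\<kappa>: "\<theta> (\<kappa> i w) = p i w" if "i \<in> I" "w \<in> points (W i)" for i w
    using fun_cong[OF \<theta>p[rule_format, OF that(1)], of w] that(2) by (simp add: compose_eq)
  have surj: "\<theta> ` points S' = points C'"
  proof
    show "\<theta> ` points S' \<subseteq> points C'" using continuous_PiE[OF \<theta>] by auto
    show "points C' \<subseteq> \<theta> ` points S'"
    proof
      fix c assume c: "c \<in> points C'"
      then have "h c \<in> \<eta> ` points S" using continuous_PiE[OF h] \<eta>(2) by auto
      then obtain s where s: "s \<in> points S" "h c = \<eta> s" by blast
      then obtain i x where ix: "i \<in> I" "x \<in> points (Cs i)" "\<iota> i x = s"
        using coproduct_jointly_surjective[OF S] by blast
      then have "h c = k i x" using s by (simp add: k_def compose_eq)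
      then obtain w where w: "w \<in> points (W i)" "p i w = c"
        using lift ix c by blast
      then have "\<theta> (\<kappa> i w) = c" using \<theta>\<kappa> ix by simp
      then show "c \<in> \<theta> ` points S'" using w(1) continuous_PiE[OF \<kappa>[OF ix(1)]] by blast
    qed
  qed
  let ?\<delta> = "\<lambda>c\<in>points C'. app (\<alpha> (h c)) (\<beta> c)"
  define \<delta>s where "\<delta>s i = (\<lambda>w\<in>points (W i). ?\<delta> (\<theta> (\<kappa> i w)))" for i
  show "?\<delta> \<in> admissible B C'"
  proof (rule admissible_cover[OF B C' _ I])
    show "?\<delta> \<in> points C' \<rightarrow>\<^sub>E qpoints B"
      using app_qexp_in PiE_mem[OF \<alpha>] PiE_mem[OF continuous_PiE[OF h]] PiE_mem[OF admissible_PiE[OF A \<beta>]]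
      by simp
    show "is_covered D C' ?\<delta> I W \<delta>s"
      unfolding is_covered_iff \<delta>s_def using S' \<theta> surj by blast
    fix i assume i: "i \<in> I"
    show "W i \<in> CompHaus D" by (rule W[OF i])
    have "(\<lambda>w\<in>points (W i). app (\<alpha>s i (q i w)) (compose (points (W i)) \<beta> (p i) w)) \<in>
          admissible B (W i)"
      using \<alpha>s[OF i] W[OF i] q[OF i] admissible_reparam[OF A W[OF i] C' p[OF i] \<beta>]
      unfolding admissible_qexp_iff[OF Cs[OF i]] by blast
    also have "(\<lambda>w\<in>points (W i). app (\<alpha>s i (q i w)) (compose (points (W i)) \<beta> (p i) w)) = \<delta>s i"
    proof (rule ext)
      fix w
      show "(\<lambda>w\<in>points (W i). app (\<alpha>s i (q i w)) (compose (points (W i)) \<beta> (p i) w)) w = \<delta>s i w"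
      proof (cases "w \<in> points (W i)")
        case True
        have "q i w \<in> points (Cs i)" "p i w \<in> points C'"
          using PiE_mem[OF continuous_PiE[OF q[OF i]] True] PiE_mem[OF continuous_PiE[OF p[OF i]] True] .
        moreover from this have "\<alpha>s i (q i w) = \<alpha> (h (p i w))"
          using \<alpha>s_eq i square[OF i True] by (simp add: k_def compose_eq)
        ultimately show ?thesis
          using True by (simp add: \<delta>s_def \<theta>\<kappa>[OF i True] compose_eq)
      qed (simp add: \<delta>s_def)
    qed
    finally show "\<delta>s i \<in> admissible B (W i)" .
  qed
qed

lemma is_quasi_space_qexp: "is_quasi_space D (qexp A B)"
proof (rule is_quasi_spaceI)
  show "small (qpoints (qexp A B))"
    unfolding qpoints_qexp
    by (rule small_graph_codes[OF quasi_small[OF A] quasi_small[OF B]]) (auto dest: qcontinuous_PiE)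
  fix C assume "C \<notin> CompHaus D"
  then show "admissible (qexp A B) C = {}" by (simp add: qexp_def)
next
  fix C \<phi> assume C: "C \<in> CompHaus D" and \<phi>: "\<phi> \<in> qpoints (qexp A B)"
  have "(\<lambda>c\<in>points C'. app ((\<lambda>c\<in>points C. \<phi>) (h c)) (\<beta> c)) = (\<lambda>c\<in>points C'. app \<phi> (\<beta> c))"
    if "h \<in> continuous C' C" for C' h \<beta>
    using continuous_PiE[OF that] by (auto simp: fun_eq_iff)
  then show "(\<lambda>c\<in>points C. \<phi>) \<in> admissible (qexp A B) C"
    using \<phi> app_qexp_admissible[OF \<phi>] by (simp add: admissible_qexp_iff[OF C])
next
  fix C C' h \<alpha>
  assume C: "C \<in> CompHaus D" "C' \<in> CompHaus D" and h: "h \<in> continuous C C'"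
    and \<alpha>: "\<alpha> \<in> admissible (qexp A B) C'"
  have "(\<lambda>c\<in>points K. app (compose (points C) \<alpha> h (g c)) (\<beta> c)) \<in> admissible B K"
    if K: "K \<in> CompHaus D" and g: "g \<in> continuous K C" and \<beta>: "\<beta> \<in> admissible A K" for K g \<beta>
  proof -
    have "compose (points K) h g \<in> continuous K C'"
      by (intro continuous_compose[OF _ CompHaus_space[OF C(1)]] CompHaus_space K C g h)
    then have "(\<lambda>c\<in>points K. app (\<alpha> (compose (points K) h g c)) (\<beta> c)) \<in> admissible B K"
      using \<alpha> K \<beta> by (simp add: admissible_qexp_iff[OF C(2)])
    also have "(\<lambda>c\<in>points K. app (\<alpha> (compose (points K) h g c)) (\<beta> c)) =
               (\<lambda>c\<in>points K. app (compose (points C) \<alpha> h (g c)) (\<beta> c))"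
      using PiE_mem[OF continuous_PiE[OF g]] by (simp add: fun_eq_iff compose_eq)
    finally show ?thesis .
  qed
  moreover have "compose (points C) \<alpha> h \<in> points C \<rightarrow>\<^sub>E qpoints (qexp A B)"
    using \<alpha> continuous_PiE[OF h] by (auto simp: admissible_qexp_iff[OF C(2)] compose_def)
  ultimately show "compose (points C) \<alpha> h \<in> admissible (qexp A B) C"
    by (simp add: admissible_qexp_iff[OF C(1)])
qed (use qexp_cover admissible_qexp_iff in blast)+

abbreviation qeval :: "'u \<Rightarrow> 'u" where
  "qeval \<equiv> \<lambda>p\<in>pairs (qpoints (qexp A B)) (qpoints A). app (pfst p) (psnd p)"

lemma qeval_qcontinuous: "qeval \<in> qcontinuous (qproduct (qexp A B) A) B"
proof -
  let ?E = "qexp A B"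
  have "compose (points C) qeval \<gamma> \<in> admissible B C"
    if C: "C \<in> CompHaus D" and \<gamma>: "\<gamma> \<in> admissible (qproduct ?E A) C" for C \<gamma>
  proof -
    let ?\<alpha> = "compose (points C) (proj1 (qpoints ?E) (qpoints A)) \<gamma>"
    let ?\<beta> = "compose (points C) (proj2 (qpoints ?E) (qpoints A)) \<gamma>"
    have \<gamma>E: "\<gamma> \<in> points C \<rightarrow>\<^sub>E pairs (qpoints ?E) (qpoints A)"
      and \<alpha>: "?\<alpha> \<in> admissible ?E C" and \<beta>: "?\<beta> \<in> admissible A C"
      using \<gamma> unfolding qproduct_def admissible_initial[OF C] by blast+
    have "(\<lambda>c\<in>points C. app (?\<alpha> ((\<lambda>c\<in>points C. c) c)) (?\<beta> c)) \<in> admissible B C"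
      using \<alpha> \<beta> C continuous_id[OF CompHaus_space[OF C]] unfolding admissible_qexp_iff[OF C] by blast
    also have "(\<lambda>c\<in>points C. app (?\<alpha> ((\<lambda>c\<in>points C. c) c)) (?\<beta> c)) = compose (points C) qeval \<gamma>"
      using PiE_mem[OF \<gamma>E] by (simp add: fun_eq_iff compose_def)
    finally show ?thesis .
  qed
  moreover have "qeval \<in> pairs (qpoints ?E) (qpoints A) \<rightarrow>\<^sub>E qpoints B"
    using app_qexp_in by (auto elim!: pairsE)
  ultimately show ?thesis by (simp add: quasi_continuous_maps_def)
qed

lemma transpose_qcontinuous:
  assumes Z: "is_quasi_space D Z" and F: "F \<in> qcontinuous (qproduct Z A) B"
  shows "(\<lambda>z\<in>qpoints Z. graph_code (qpoints A) (\<lambda>a\<in>qpoints A. F (pair z a))) \<in> qcontinuous Z (qexp A B)"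
    (is "?g \<in> _")
proof -
  have F_adm: "(\<lambda>c\<in>points C. F (pair (\<alpha> c) (\<beta> c))) \<in> admissible B C"
    if C: "C \<in> CompHaus D" and \<alpha>: "\<alpha> \<in> admissible Z C" and \<beta>: "\<beta> \<in> admissible A C" for C \<alpha> \<beta>
    using qcontinuous_admissible[OF F C admissible_pairing[OF C Z A \<alpha> \<beta>]]
    by (simp add: compose_def cong: restrict_cong)
  have "(\<lambda>a\<in>qpoints A. F (pair z a)) \<in> qcontinuous A B" if z: "z \<in> qpoints Z" for z
  proof -
    have "compose (points C) (\<lambda>a\<in>qpoints A. F (pair z a)) \<beta> \<in> admissible B C"
      if C: "C \<in> CompHaus D" and \<beta>: "\<beta> \<in> admissible A C" for C \<beta>
    proof -
      have "compose (points C) (\<lambda>a\<in>qpoints A. F (pair z a)) \<beta> =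
            (\<lambda>c\<in>points C. F (pair ((\<lambda>c\<in>points C. z) c) (\<beta> c)))"
        using PiE_mem[OF admissible_PiE[OF A \<beta>]] by (simp add: fun_eq_iff compose_def)
      then show ?thesis
        using F_adm[OF C admissible_const[OF Z C z] \<beta>] by simp
    qed
    moreover have "(\<lambda>a\<in>qpoints A. F (pair z a)) \<in> qpoints A \<rightarrow>\<^sub>E qpoints B"
      using PiE_mem[OF qcontinuous_PiE[OF F]] z by simp
    ultimately show ?thesis by (simp add: quasi_continuous_maps_def)
  qed
  then have gE: "?g \<in> qpoints Z \<rightarrow>\<^sub>E qpoints (qexp A B)"
    by (simp add: qpoints_qexp)
  have "compose (points C) ?g \<gamma> \<in> admissible (qexp A B) C"
    if C: "C \<in> CompHaus D" and \<gamma>: "\<gamma> \<in> admissible Z C" for C \<gamma>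
    unfolding admissible_qexp_iff[OF C]
  proof (intro conjI ballI)
    note \<gamma>E = admissible_PiE[OF Z \<gamma>]
    show "compose (points C) ?g \<gamma> \<in> points C \<rightarrow>\<^sub>E qpoints (qexp A B)"
      using PiE_mem[OF gE] PiE_mem[OF \<gamma>E] by (simp add: compose_def)
    fix C' h \<beta>
    assume C': "C' \<in> CompHaus D" and h: "h \<in> continuous C' C" and \<beta>: "\<beta> \<in> admissible A C'"
    have "(\<lambda>c\<in>points C'. F (pair (compose (points C') \<gamma> h c) (\<beta> c))) \<in> admissible B C'"
      by (rule F_adm[OF C' admissible_reparam[OF Z C' C h \<gamma>] \<beta>])
    also have "(\<lambda>c\<in>points C'. F (pair (compose (points C') \<gamma> h c) (\<beta> c))) =
               (\<lambda>c\<in>points C'. app (compose (points C) ?g \<gamma> (h c)) (\<beta> c))"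
      using PiE_mem[OF continuous_PiE[OF h]] PiE_mem[OF \<gamma>E] PiE_mem[OF admissible_PiE[OF A \<beta>]]
      by (simp add: fun_eq_iff compose_def app_graph_code quasi_small[OF A])
    finally show "(\<lambda>c\<in>points C'. app (compose (points C) ?g \<gamma> (h c)) (\<beta> c)) \<in> admissible B C'" .
  qed
  then show ?thesis using gE by (simp add: quasi_continuous_maps_def)
qed

lemma is_exponential_QsCat:
  "is_exponential (QsCat D) A B (qexp A B) (qproduct (qexp A B) A)
     (proj1 (qpoints (qexp A B)) (qpoints A)) (proj2 (qpoints (qexp A B)) (qpoints A)) qeval"
proof -
  let ?E = "qexp A B"
  let ?P = "qproduct ?E A"
  let ?p = "proj1 (qpoints ?E) (qpoints A)" and ?q = "proj2 (qpoints ?E) (qpoints A)"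
  note E = is_quasi_space_qexp
  have "\<exists>!g. g \<in> qcontinuous Z ?E \<and>
          (\<exists>u\<in>qcontinuous R ?P. compose (qpoints R) ?p u = compose (qpoints R) g p' \<and>
             compose (qpoints R) ?q u = q' \<and> compose (qpoints R) qeval u = f)"
    if prod: "is_product (QsCat D) Z A R p' q'" and f: "f \<in> qcontinuous R B" for Z R p' q' f
  proof -
    note Z = QsCat_productD(1)[OF prod] and R = QsCat_productD(3)[OF prod]
      and p' = QsCat_productD(4)[OF prod] and q' = QsCat_productD(5)[OF prod]
    note pE' = PiE_mem[OF qcontinuous_PiE[OF p']] and qE' = PiE_mem[OF qcontinuous_PiE[OF q']]
    note ZA = is_quasi_space_qproduct[OF Z A]
    obtain w where w: "w \<in> qcontinuous (qproduct Z A) R"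
      and pw: "\<And>z a. z \<in> qpoints Z \<Longrightarrow> a \<in> qpoints A \<Longrightarrow> p' (w (pair z a)) = z"
      and qw: "\<And>z a. z \<in> qpoints Z \<Longrightarrow> a \<in> qpoints A \<Longrightarrow> q' (w (pair z a)) = a"
      and wpq: "\<And>r. r \<in> qpoints R \<Longrightarrow> w (pair (p' r) (q' r)) = r"
      by (rule product_comparison[OF prod]) blast
    have wR: "w (pair z a) \<in> qpoints R" if "z \<in> qpoints Z" "a \<in> qpoints A" for z a
      using PiE_mem[OF qcontinuous_PiE[OF w], of "pair z a"] that by simp
    define F where "F = compose (qpoints (qproduct Z A)) f w"
    have F: "F \<in> qcontinuous (qproduct Z A) B"
      unfolding F_def by (rule qcontinuous_compose[OF ZA w f])
    have F_pair: "F (pair z a) = f (w (pair z a))" if "z \<in> qpoints Z" "a \<in> qpoints A" for z a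
      using that by (simp add: F_def compose_eq)
    let ?g = "\<lambda>z\<in>qpoints Z. graph_code (qpoints A) (\<lambda>a\<in>qpoints A. F (pair z a))"
    have g: "?g \<in> qcontinuous Z ?E" by (rule transpose_qcontinuous[OF Z F])
    show ?thesis
    proof (rule ex1I[of _ ?g], intro conjI g)
      have "compose (qpoints R) ?g p' \<in> qcontinuous R ?E"
        by (rule qcontinuous_compose[OF R p' g])
      then obtain u where u: "u \<in> qcontinuous R ?P"
        and u1: "compose (qpoints R) ?p u = compose (qpoints R) ?g p'"
        and u2: "compose (qpoints R) ?q u = q'"
        using QsCat_productD(6)[OF is_product_QsCat[OF E A] R _ q'] by blast
      have "compose (qpoints R) qeval u r = f r" for r
      proof (cases "r \<in> qpoints R")
        case True
        then have "u r \<in> pairs (qpoints ?E) (qpoints A)"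
          using PiE_mem[OF qcontinuous_PiE[OF u]] by simp
        then have "compose (qpoints R) qeval u r = app (?g (p' r)) (q' r)"
          using True fun_cong[OF u1, of r] fun_cong[OF u2, of r] by (simp add: compose_eq)
        also have "\<dots> = f r"
          using True by (simp add: pE' qE' app_graph_code quasi_small[OF A] F_pair wpq)
        finally show ?thesis .
      next
        case False
        then show ?thesis using PiE_arb[OF qcontinuous_PiE[OF f] False] by (simp add: compose_def)
      qed
      then have "compose (qpoints R) qeval u = f" by (rule ext)
      with u u1 u2 show "\<exists>u\<in>qcontinuous R ?P. compose (qpoints R) ?p u = compose (qpoints R) ?g p' \<and>
          compose (qpoints R) ?q u = q' \<and> compose (qpoints R) qeval u = f" by blast
    next
      fix g' assume "g' \<in> qcontinuous Z ?E \<and>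
        (\<exists>u\<in>qcontinuous R ?P. compose (qpoints R) ?p u = compose (qpoints R) g' p' \<and>
          compose (qpoints R) ?q u = q' \<and> compose (qpoints R) qeval u = f)"
      then obtain u where g': "g' \<in> qcontinuous Z ?E" and u: "u \<in> qcontinuous R ?P"
        and u1: "compose (qpoints R) ?p u = compose (qpoints R) g' p'"
        and u2: "compose (qpoints R) ?q u = q'" and ev: "compose (qpoints R) qeval u = f" by blast
      have app_g': "app (g' z) a = F (pair z a)" if za: "z \<in> qpoints Z" "a \<in> qpoints A" for z a
      proof -
        let ?r = "w (pair z a)"
        note r = wR[OF za]
        have "u ?r \<in> pairs (qpoints ?E) (qpoints A)"
          using PiE_mem[OF qcontinuous_PiE[OF u] r] by simp
        then show ?thesis
          using fun_cong[OF u1, of ?r] fun_cong[OF u2, of ?r] fun_cong[OF ev, of ?r] r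
          by (simp add: compose_eq pw[OF za] qw[OF za] F_pair[OF za])
      qed
      show "g' = ?g"
      proof (rule extensionalityI[of _ "qpoints Z"])
        fix z assume z: "z \<in> qpoints Z"
        have "g' z = graph_code (qpoints A) (\<lambda>a\<in>qpoints A. F (pair z a))"
          by (rule qexp_eqI[OF PiE_mem[OF qcontinuous_PiE[OF g'] z]]) (simp add: app_g' z)
        then show "g' z = ?g z" using z by simp
      qed (use qcontinuous_PiE[OF g'] in \<open>auto simp: PiE_iff\<close>)
    qed
  qed
  then show ?thesis
    using B is_product_QsCat[OF E A] qeval_qcontinuous
    unfolding is_exponential_def by (simp add: QsCat_def)
qed

end

lemma cartesian_closed_QsCat: "cartesian_closed (QsCat D)"
  unfolding cartesian_closed_def
proof (intro conjI ballI)
  show "is_category (QsCat D)" by (rule is_category_QsCat)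
  show "\<exists>t. is_terminal (QsCat D) t" using is_terminal_QsCat by blast
  fix A B assume "A \<in> Obj (QsCat D)" "B \<in> Obj (QsCat D)"
  then have "is_quasi_space D A" "is_quasi_space D B" by (simp_all add: QsCat_def)
  then show "\<exists>P p q. is_product (QsCat D) A B P p q"
    and "\<exists>E P p q ev. is_exponential (QsCat D) A B E P p q ev"
    using is_product_QsCat is_exponential_QsCat by blast+
qed

end

section \<open>Cartesian closedness\<close>

theorem mainTheorem3:
  fixes D :: "('u::set_universe, 'v::heyting_comm_quantale) monad_data"
  assumes "is_setting D"
    and "constants_continuous D"
    and "CompHaus_closed D"
  shows "cartesian_closed (QsCat D)"
proof -
  interpret closed_setting D
    using assms(1,3) by unfold_locales
  show ?thesis by (rule cartesian_closed_QsCat)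
qed

end
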